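(* Let $R=(r_{ij})$ be a real symmetric $n\times n$ matrix with zero diagonal and $\rho(|R|)<1$, with graph $G$, GaBP messages $\alpha$, and belief-propagation estimate $Z^{\mathrm{bp}}$ (defined in the context). For each directed edge $(ij)$ of $G$ set $r'_{ij}=\frac{r_{ij}}{1-\alpha_{i\setminus j}}$. Then $$\det(I-R)^{-1}=Z^{\mathrm{bp}}\times\prod_{\gamma}\Big(1-\prod_{(ij)}(r'_{ij})^{n_{ij}(\gamma)}\Big)^{-1},$$ where the outer product is over all (nonempty) backtrackless orbits $\gamma$ of $G$.
   Context: $|R|=(|r_{ij}|)$ is the entrywise absolute value and $\rho$ the spectral radius. $G$ is the graph on $V=\{1,\dots,n\}$ with undirected edge $\{i,j\}$ whenever $r_{ij}\neq0$; $\partial i$ is the set of neighbours of $i$; each edge gives directed edges $(ij),(ji)$. A walk is a sequence of vertices $(w_0,\dots,w_L)$ with $\{w_t,w_{t+1}\}\in G$; steps are $(w_tw_{t+1})$; closed means $L\ge1$, $w_0=w_L$; a closed walk is primitive if it is not an $m$-fold concatenation ($m\ge2$) of a shorter closed walk. An orbit is an equivalence class of closed primitive walks under cyclic shifts; $n_{ij}(\gamma)$ is the number of occurrences of step $(ij)$ in orbit $\gamma$. An orbit is regarded as a cyclic sequence of steps; a backtracking pair is a pair of cyclically consecutive steps $(ij)(ji)$; an orbit is backtrackless if it has no backtracking pair. GaBP messages: $\alpha_{ij}=\lim_t\alpha^{(t)}_{ij}$ with $\alpha^{(0)}_{ij}=0$, $\alpha^{(t+1)}_{ij}=r_{ij}^2(1-\sum_{k\in\partial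 i\setminus j}\alpha^{(t)}_{ki})^{-1}$ (convergent when $\rho(|R|)<1$, with $1-\alpha_{i\setminus j}>0$). $\alpha_{i\setminus j}=\sum_{k\in\partial i\setminus j}\alpha_{ki}$. $Z_i^{\mathrm{bp}}=(1-\sum_{k\in\partial i}\alpha_{ki})^{-1}$, $Z_{ij}^{\mathrm{bp}}=\det\begin{pmatrix}1-\alpha_{i\setminus j} & -r_{ij}\\ -r_{ij} & 1-\alpha_{j\setminus i}\end{pmatrix}^{-1}$, $Z^{\mathrm{bp}}=\prod_{i\in V}Z_i^{\mathrm{bp}}\prod_{\{i,j\}\in G}\frac{Z_{ij}^{\mathrm{bp}}}{Z_i^{\mathrm{bp}}Z_j^{\mathrm{bp}}}$. *)

theory Defs
  imports "Jordan_Normal_Form.Spectral_Radius"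
begin

definition nbrs :: "real mat \<Rightarrow> nat \<Rightarrow> nat set" where
  "nbrs R i = {k. k < dim_row R \<and> R $$ (i, k) \<noteq> 0}"

fun alpha_iter :: "real mat \<Rightarrow> nat \<Rightarrow> nat \<Rightarrow> nat \<Rightarrow> real" where
  "alpha_iter R 0 i j = 0"
| "alpha_iter R (Suc t) i j =
     (R $$ (i, j))\<^sup>2 * inverse (1 - (\<Sum>k\<in>nbrs R i - {j}. alpha_iter R t k i))"

definition alpha :: "real mat \<Rightarrow> nat \<Rightarrow> nat \<Rightarrow> real" where
  "alpha R i j = lim (\<lambda>t. alpha_iter R t i j)"

definition alpha_excl :: "real mat \<Rightarrow> nat \<Rightarrow> nat \<Rightarrow> real" where
  "alpha_excl R i j = (\<Sum>k\<in>nbrs R i - {j}. alpha R k i)"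

definition Z_node :: "real mat \<Rightarrow> nat \<Rightarrow> real" where
  "Z_node R i = inverse (1 - (\<Sum>k\<in>nbrs R i. alpha R k i))"

definition Z_edge :: "real mat \<Rightarrow> nat \<Rightarrow> nat \<Rightarrow> real" where
  "Z_edge R i j = inverse (det (mat_of_rows_list 2
      [[1 - alpha_excl R i j, - R $$ (i, j)],
       [- R $$ (i, j), 1 - alpha_excl R j i]]))"

definition undir_edges :: "real mat \<Rightarrow> (nat \<times> nat) set" where
  "undir_edges R = {(i, j). i < j \<and> j < dim_row R \<and> R $$ (i, j) \<noteq> 0}"

definition dir_edges :: "real mat \<Rightarrow> (nat \<times> nat) set" where
  "dir_edges R = {(i, j). i < dim_row R \<and> j < dim_row R \<and> R $$ (i, j) \<noteq> 0}"

definition Z_bp :: "real mat \<Rightarrow> real" where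
  "Z_bp R = (\<Prod>i<dim_row R. Z_node R i) *
     (\<Prod>(i, j)\<in>undir_edges R. Z_edge R i j / (Z_node R i * Z_node R j))"

definition r_prime :: "real mat \<Rightarrow> nat \<Rightarrow> nat \<Rightarrow> real" where
  "r_prime R i j = R $$ (i, j) / (1 - alpha_excl R i j)"

definition is_walk :: "real mat \<Rightarrow> nat list \<Rightarrow> bool" where
  "is_walk R ws \<longleftrightarrow> ws \<noteq> [] \<and> set ws \<subseteq> {..<dim_row R} \<and>
     (\<forall>t < length ws - 1. R $$ (ws ! t, ws ! (t + 1)) \<noteq> 0)"

definition steps :: "nat list \<Rightarrow> (nat \<times> nat) list" where
  "steps ws = zip ws (tl ws)"

definition is_closed_walk :: "real mat \<Rightarrow> nat list \<Rightarrow> bool" where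
  "is_closed_walk R ws \<longleftrightarrow> is_walk R ws \<and> length ws \<ge> 2 \<and> hd ws = last ws"

definition walk_pow :: "nat list \<Rightarrow> nat \<Rightarrow> nat list" where
  "walk_pow c m = hd c # concat (replicate m (tl c))"

definition is_primitive :: "real mat \<Rightarrow> nat list \<Rightarrow> bool" where
  "is_primitive R ws \<longleftrightarrow> is_closed_walk R ws \<and>
     \<not> (\<exists>c m. m \<ge> 2 \<and> is_closed_walk R c \<and> length c < length ws \<and> ws = walk_pow c m)"

text \<open>Cyclic shifts of a closed walk correspond to rotations of its step sequence.\<close>
definition cyc_equiv :: "nat list \<Rightarrow> nat list \<Rightarrow> bool" where
  "cyc_equiv ws ws' \<longleftrightarrow> (\<exists>k. steps ws' = rotate k (steps ws))"

definition orbits :: "real mat \<Rightarrow> nat list set set" where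
  "orbits R = {{ws'. is_primitive R ws' \<and> cyc_equiv ws ws'} | ws. is_primitive R ws}"

definition orbit_steps :: "nat list set \<Rightarrow> (nat \<times> nat) list" where
  "orbit_steps \<gamma> = steps (SOME ws. ws \<in> \<gamma>)"

definition n_step :: "nat list set \<Rightarrow> nat \<Rightarrow> nat \<Rightarrow> nat" where
  "n_step \<gamma> i j = count_list (orbit_steps \<gamma>) (i, j)"

definition backtrackless :: "nat list set \<Rightarrow> bool" where
  "backtrackless \<gamma> \<longleftrightarrow> (let s = orbit_steps \<gamma>; L = length s in
     \<forall>t < L. s ! ((t + 1) mod L) \<noteq> (snd (s ! t), fst (s ! t)))"

definition backtrackless_orbits :: "real mat \<Rightarrow> nat list set set" where
  "backtrackless_orbits R = {\<gamma> \<in> orbits R. backtrackless \<gamma>}"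

definition orbit_weight :: "real mat \<Rightarrow> nat list set \<Rightarrow> real" where
  "orbit_weight R \<gamma> = (\<Prod>(i, j)\<in>dir_edges R. (r_prime R i j) ^ n_step \<gamma> i j)"

end

theory Submission
  imports "HOL-Analysis.Complex_Transcendental" "HOL-Analysis.Infinite_Sum" Defs
begin

text \<open>
  Let \<open>M\<close> be the non-backtracking matrix on directed edges with weights \<open>u\<^sub>e = r'\<^sub>e\<close>, that is
  \<open>M\<^sub>e\<^sub>f = u\<^sub>f\<close> if \<open>f\<close> starts where \<open>e\<close> ends and is not the reversal of \<open>e\<close>. Every word is
  uniquely a power of a primitive word, and \<open>tr M\<^sup>k\<close> is a sum of weights of cyclic words of length
  \<open>k\<close>. Hence \<open>- ln det (I - M) = \<Sum>\<^sub>k tr M\<^sup>k / k\<close> equals \<open>- \<Sum>\<^sub>\<gamma> ln (1 - u\<^sup>\<gamma>)\<close> over the primitive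
  necklaces, and only backtrackless orbits have nonzero weight. A Bass-type formula reduces
  \<open>det (I - M)\<close> to an \<open>n \<times> n\<close> determinant, which by the fixed-point equations of the messages is
  \<open>Z\<^sub>b\<^sub>p det (I - R)\<close>.

  All estimates come from one vector \<open>x > 0\<close> with \<open>|R| x < x\<close>, namely \<open>x = \<Sum>\<^sub>k |R|\<^sup>k 1\<close>: it gives
  \<open>\<alpha>\<^sub>i\<^sub>j \<le> |r\<^sub>i\<^sub>j| x\<^sub>i / x\<^sub>j\<close>, hence convergence of the messages, and
  \<open>v\<^sub>i\<^sub>j = |r\<^sub>i\<^sub>j| (x\<^sub>i - |u\<^sub>i\<^sub>j| x\<^sub>j)\<close> satisfies \<open>0 < v\<close> and \<open>v |M| < v\<close>, so the spectra of \<open>M\<close> and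
  \<open>|M|\<close> lie in the open unit disc and the sums converge absolutely.
\<close>

section \<open>Primitive words and necklaces\<close>

primrec word_pow :: "'a list \<Rightarrow> nat \<Rightarrow> 'a list" where
  "word_pow w 0 = []"
| "word_pow w (Suc m) = w @ word_pow w m"

lemma word_pow_eq_concat_replicate: "word_pow w m = concat (replicate m w)"
  by (induction m) auto

lemma length_word_pow [simp]: "length (word_pow w m) = m * length w"
  by (induction m) auto

lemma word_pow_add: "word_pow w (a + b) = word_pow w a @ word_pow w b"
  by (induction a) auto

lemma word_pow_mult: "word_pow w (a * b) = word_pow (word_pow w a) b"
  by (induction b) (auto simp: word_pow_add)

lemma append_word_pow_commute: "w @ word_pow w m = word_pow w m @ w"
  by (induction m) auto

lemma word_pow_eq_Nil_iff [simp]: "word_pow w m = [] \<longleftrightarrow> w = [] \<or> m = 0"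
  by (induction m) auto

lemma hd_word_pow: "w \<noteq> [] \<Longrightarrow> m > 0 \<Longrightarrow> hd (word_pow w m) = hd w"
  by (cases m) auto

lemma map_word_pow: "map f (word_pow w m) = word_pow (map f w) m"
  by (induction m) auto

lemma set_word_pow: "m > 0 \<Longrightarrow> set (word_pow w m) = set w"
  by (simp add: word_pow_eq_concat_replicate)

lemma zip_word_pow: "length v = length w \<Longrightarrow> zip (word_pow v m) (word_pow w m) = word_pow (zip v w) m"
  by (induction m) auto

lemma prod_list_word_pow: "prod_list (word_pow w m) = prod_list w ^ m"
  by (induction m) auto

lemma rotate1_word_pow: "rotate1 (word_pow w m) = word_pow (rotate1 w) m"
proof (cases w)
  case (Cons a v)
  have "word_pow (a # v) m @ [a] = a # word_pow (v @ [a]) m"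
    by (induction m) auto
  then show ?thesis using Cons by (cases m) auto
next
  case Nil
  then show ?thesis by (induction m) auto
qed

lemma rotate_word_pow: "rotate k (word_pow w m) = word_pow (rotate k w) m"
  by (induction k) (auto simp: rotate1_word_pow)

lemma prod_list_rotate [simp]: "prod_list (rotate k w) = (prod_list w :: 'a::comm_monoid_mult)"
  by (metis append_take_drop_id mult.commute prod_list.append rotate_drop_take)

lemma rotate_rotate_inverse: "rotate ((length w - 1) * k) (rotate k w) = w"
proof (cases "w = []")
  case False
  then have "(length w - 1) * k + k = length w * k"
    by (cases w) auto
  then show ?thesis by (simp add: rotate_rotate)
qed simp

definition primitive_word :: "'a list \<Rightarrow> bool" where
  "primitive_word p \<longleftrightarrow> p \<noteq> [] \<and> (\<forall>w m. p = word_pow w m \<longrightarrow> m = 1)"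

lemma primitive_wordD: "primitive_word p \<Longrightarrow> p = word_pow w m \<Longrightarrow> m = 1"
  by (simp add: primitive_word_def)

lemma primitive_word_nonempty: "primitive_word p \<Longrightarrow> p \<noteq> []"
  by (simp add: primitive_word_def)

lemma primitive_root_exists:
  assumes "w \<noteq> []"
  obtains p m where "primitive_word p" "m > 0" "w = word_pow p m"
proof -
  have "\<exists>p m. primitive_word p \<and> m > 0 \<and> w = word_pow p m"
    using assms
  proof (induction "length w" arbitrary: w rule: less_induct)
    case less
    show ?case
    proof (cases "primitive_word w")
      case True
      then show ?thesis by (intro exI[of _ w] exI[of _ 1]) auto
    next
      case False
      then obtain v m where w: "w = word_pow v m" and "m \<noteq> 1"
        using less.prems by (auto simp: primitive_word_def)
      with less.prems have "v \<noteq> []" "m > 1" by (auto simp: neq_Nil_conv)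
      then have "length v < length w" by (simp add: w)
      from less.hyps[OF this \<open>v \<noteq> []\<close>] obtain p k where
        "primitive_word p" "k > 0" "v = word_pow p k" by blast
      then show ?thesis using w \<open>m > 1\<close>
        by (intro exI[of _ p] exI[of _ "k * m"]) (simp add: word_pow_mult)
    qed
  qed
  then show ?thesis using that by blast
qed

lemma commuting_words_are_powers:
  assumes "v @ w = w @ v"
  obtains z a b where "v = word_pow z a" "w = word_pow z b"
  using comm_append_are_replicate[OF assms] by (metis word_pow_eq_concat_replicate)

lemma commuting_primitive_words_eq:
  assumes "primitive_word p" "primitive_word q" "p @ q = q @ p"
  shows "p = q"
  using commuting_words_are_powers[OF assms(3)] assms(1,2) by (metis primitive_wordD)

text \<open>
  Both \<open>p @ q\<close> and \<open>q @ p\<close> are prefixes of the common power, which is long enough because the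
  longer root is repeated at least twice.
\<close>

lemma word_pow_eq_imp_commute:
  assumes eq: "word_pow p m = word_pow q k" and m: "m > 0" and k: "k \<ge> 2"
    and le: "length p \<le> length q"
  shows "p @ q = q @ p"
proof -
  let ?w = "word_pow p m" and ?l = "length p + length q"
  have "?l \<le> 2 * length q" using le by simp
  also have "\<dots> \<le> length ?w" using k by (simp add: eq)
  finally have long: "?l \<le> length ?w" .
  obtain k' where k': "k = Suc k'" using k by (cases k) auto
  obtain m' where m': "m = Suc m'" using m by (cases m) auto
  have "p @ q = take ?l (p @ ?w)" by (simp add: eq k')
  also have "\<dots> = take ?l ?w" using long by (simp add: append_word_pow_commute)
  also have "\<dots> = take ?l (?w @ q)" using long by simp
  also have "\<dots> = take ?l (q @ ?w)" by (simp add: eq append_word_pow_commute)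
  also have "\<dots> = q @ p" by (simp add: m')
  finally show ?thesis .
qed

lemma primitive_root_unique:
  assumes "primitive_word p" "primitive_word q" "word_pow p m = word_pow q k" "m > 0" "k > 0"
  shows "p = q \<and> m = k"
proof -
  have eq_if_le: "p = q"
    if "primitive_word p" "primitive_word q" "word_pow p m = word_pow q k" "m > 0" "k > 0"
      "length p \<le> length q" for p q :: "'a list" and m k
  proof (cases "k = 1")
    case True
    then have q: "q = word_pow p m" using that(3) by simp
    then show ?thesis using primitive_wordD[OF that(2) q] by simp
  next
    case False
    then have "p @ q = q @ p" using that by (intro word_pow_eq_imp_commute) auto
    then show ?thesis by (rule commuting_primitive_words_eq[OF that(1,2)])
  qed
  have "p = q"
    using eq_if_le[OF assms] eq_if_le[OF assms(2,1) assms(3)[symmetric] assms(5,4)]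
    by (metis nat_le_linear)
  moreover from this have "m * length p = k * length p"
    using arg_cong[OF assms(3), of length] by simp
  ultimately show ?thesis using assms(1) by (simp add: primitive_word_def)
qed

lemma primitive_word_rotate:
  assumes "primitive_word p"
  shows "primitive_word (rotate k p)"
  unfolding primitive_word_def
proof (intro conjI allI impI)
  show "rotate k p \<noteq> []" using assms by (simp add: primitive_word_def)
  fix w m assume "rotate k p = word_pow w m"
  then have "p = word_pow (rotate ((length p - 1) * k) w) m"
    by (metis rotate_rotate_inverse rotate_word_pow)
  then show "m = 1" by (rule primitive_wordD[OF assms])
qed

lemma rotate_primitive_word_neq:
  assumes "primitive_word p" "0 < k" "k < length p"
  shows "rotate k p \<noteq> p"
proof
  assume "rotate k p = p"
  then have "drop k p @ take k p = take k p @ drop k p"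
    using assms by (simp add: rotate_drop_take)
  then obtain z a b where z: "drop k p = word_pow z a" "take k p = word_pow z b"
    by (rule commuting_words_are_powers)
  then have "p = word_pow z (b + a)" by (metis append_take_drop_id word_pow_add)
  then have "b + a = 1" by (rule primitive_wordD[OF assms(1)])
  moreover have "drop k p \<noteq> []" "take k p \<noteq> []" using assms by auto
  then have "a \<noteq> 0" "b \<noteq> 0" unfolding z by auto
  ultimately show False by simp
qed

definition rotations :: "'a list \<Rightarrow> 'a list set" where
  "rotations w = range (\<lambda>k. rotate k w)"

lemma self_in_rotations: "w \<in> rotations w"
  unfolding rotations_def by (rule range_eqI[of _ _ 0]) simp

lemma rotations_eq_if_mem:
  assumes "v \<in> rotations w"
  shows "rotations v = rotations w"
proof -
  have sub: "rotations (rotate k u) \<subseteq> rotations u" for k and u :: "'a list"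
    by (auto simp: rotations_def rotate_rotate)
  obtain k where v: "v = rotate k w" using assms by (auto simp: rotations_def)
  have "rotations w \<subseteq> rotations v"
    using sub[of "(length w - 1) * k" v] by (simp only: v rotate_rotate_inverse)
  moreover have "rotations v \<subseteq> rotations w" unfolding v by (rule sub)
  ultimately show ?thesis by blast
qed

lemma rotations_eq_image: "w \<noteq> [] \<Longrightarrow> rotations w = (\<lambda>k. rotate k w) ` {..<length w}"
proof (intro equalityI subsetI)
  fix v assume "w \<noteq> []" "v \<in> rotations w"
  then obtain k where "v = rotate (k mod length w) w"
    by (metis rangeE rotate_conv_mod rotations_def)
  then show "v \<in> (\<lambda>k. rotate k w) ` {..<length w}" using \<open>w \<noteq> []\<close> by auto
qed (auto simp: rotations_def)

lemma finite_rotations: "finite (rotations w)"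
  by (cases "w = []") (auto simp: rotations_eq_image, simp add: rotations_def)

lemma card_rotations_primitive_word:
  assumes "primitive_word p"
  shows "card (rotations p) = length p"
proof -
  have "inj_on (\<lambda>k. rotate k p) {..<length p}"
  proof (rule linorder_inj_onI)
    fix a b assume ab: "a < b" "a \<in> {..<length p}" "b \<in> {..<length p}"
    have "rotate b p = rotate (b - a) (rotate a p)" using ab by (simp add: rotate_rotate)
    also have "\<dots> \<noteq> rotate a p"
      using rotate_primitive_word_neq[OF primitive_word_rotate[OF assms]] ab by auto
    finally show "rotate a p \<noteq> rotate b p" by simp
  qed auto
  then show ?thesis
    using assms by (simp add: rotations_eq_image primitive_word_nonempty card_image)
qed

definition primitive_necklaces :: "'a set \<Rightarrow> 'a list set set" where
  "primitive_necklaces S = rotations ` {p \<in> lists S. primitive_word p}"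

lemma primitive_necklaceD:
  assumes "c \<in> primitive_necklaces S" "p \<in> c"
  shows "p \<in> lists S" "primitive_word p" "c = rotations p"
proof -
  obtain q where q: "q \<in> lists S" "primitive_word q" "c = rotations q"
    using assms(1) by (auto simp: primitive_necklaces_def)
  then obtain k where k: "p = rotate k q" using assms(2) by (auto simp: rotations_def)
  show "p \<in> lists S" using q(1) by (simp add: k lists_eq_set)
  show "primitive_word p" unfolding k by (rule primitive_word_rotate[OF q(2)])
  show "c = rotations p" using rotations_eq_if_mem assms(2) q(3) by blast
qed

lemma bij_betw_word_pow:
  "bij_betw (\<lambda>(p, m). word_pow p m) ({p \<in> lists S. primitive_word p} \<times> {1..}) (lists S - {[]})"
  unfolding bij_betw_def
proof (intro conjI equalityI subsetI)
  show "inj_on (\<lambda>(p, m). word_pow p m) ({p \<in> lists S. primitive_word p} \<times> {1..})"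
    by (rule inj_onI) (auto dest: primitive_root_unique)
next
  fix w assume "w \<in> (\<lambda>(p, m). word_pow p m) ` ({p \<in> lists S. primitive_word p} \<times> {1..})"
  then show "w \<in> lists S - {[]}"
    by (auto simp: primitive_word_nonempty lists_eq_set set_word_pow)
next
  fix w assume w: "w \<in> lists S - {[]}"
  then obtain p m where p: "primitive_word p" "m > 0" "w = word_pow p m"
    by (auto elim: primitive_root_exists)
  then have "p \<in> lists S" using w by (simp add: lists_eq_set set_word_pow)
  then have "(p, m) \<in> {p \<in> lists S. primitive_word p} \<times> {1..}" using p by simp
  then show "w \<in> (\<lambda>(p, m). word_pow p m) ` ({p \<in> lists S. primitive_word p} \<times> {1..})"
    using p(3) by (force intro: rev_image_eqI)
qed

lemma bij_betw_snd_primitive_necklaces: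
  "bij_betw snd (SIGMA c:primitive_necklaces S. c) {p \<in> lists S. primitive_word p}"
  unfolding bij_betw_def
proof (intro conjI equalityI subsetI)
  show "inj_on snd (SIGMA c:primitive_necklaces S. c)"
    by (rule inj_onI) (auto dest: primitive_necklaceD(3))
next
  fix p assume "p \<in> snd ` (SIGMA c:primitive_necklaces S. c)"
  then show "p \<in> {p \<in> lists S. primitive_word p}" using primitive_necklaceD by fastforce
next
  fix p assume "p \<in> {p \<in> lists S. primitive_word p}"
  then have "(rotations p, p) \<in> (SIGMA c:primitive_necklaces S. c)"
    by (simp add: primitive_necklaces_def self_in_rotations)
  then show "p \<in> snd ` (SIGMA c:primitive_necklaces S. c)" by force
qed

definition cyclic_pairs :: "'a list \<Rightarrow> ('a \<times> 'a) list" where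
  "cyclic_pairs w = zip w (rotate1 w)"

lemma cyclic_pairs_word_pow: "cyclic_pairs (word_pow w m) = word_pow (cyclic_pairs w) m"
  by (simp add: cyclic_pairs_def rotate1_word_pow zip_word_pow)

lemma cyclic_pairs_rotate: "cyclic_pairs (rotate k w) = rotate k (cyclic_pairs w)"
proof -
  have zip_rotate1: "zip (rotate1 xs) (rotate1 ys) = rotate1 (zip xs ys)"
    if "length xs = length ys" for xs ys :: "'a list"
    using that by (cases xs; cases ys) auto
  show ?thesis by (induction k) (simp_all add: cyclic_pairs_def zip_rotate1)
qed

definition cyclic_weight :: "('a \<Rightarrow> 'a \<Rightarrow> 'b::monoid_mult) \<Rightarrow> 'a list \<Rightarrow> 'b" where
  "cyclic_weight M w = (\<Prod>(a, b)\<leftarrow>cyclic_pairs w. M a b)"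

lemma cyclic_weight_word_pow: "cyclic_weight M (word_pow w m) = cyclic_weight M w ^ m"
  by (simp add: cyclic_weight_def cyclic_pairs_word_pow map_word_pow prod_list_word_pow)

lemma cyclic_weight_rotate:
  fixes M :: "'a \<Rightarrow> 'a \<Rightarrow> 'b::comm_monoid_mult"
  shows "cyclic_weight M (rotate k w) = cyclic_weight M w"
  by (simp add: cyclic_weight_def cyclic_pairs_rotate rotate_map[symmetric])

definition necklace_weight :: "('a \<Rightarrow> 'a \<Rightarrow> 'b::monoid_mult) \<Rightarrow> 'a list set \<Rightarrow> 'b" where
  "necklace_weight M c = cyclic_weight M (SOME p. p \<in> c)"

lemma necklace_weight_eq:
  fixes M :: "'a \<Rightarrow> 'a \<Rightarrow> 'b::comm_monoid_mult"
  assumes "c \<in> primitive_necklaces S" "p \<in> c"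
  shows "necklace_weight M c = cyclic_weight M p"
proof -
  have "(SOME q. q \<in> c) \<in> c" using assms(2) by (rule someI)
  then obtain k where "(SOME q. q \<in> c) = rotate k p"
    using primitive_necklaceD(3)[OF assms] by (auto simp: rotations_def)
  then show ?thesis by (simp add: necklace_weight_def cyclic_weight_rotate)
qed

definition cyclically :: "('a \<Rightarrow> 'a \<Rightarrow> bool) \<Rightarrow> 'a list \<Rightarrow> bool" where
  "cyclically P w \<longleftrightarrow> (\<forall>(a, b) \<in> set (cyclic_pairs w). P a b)"

lemma cyclically_iff_list_all2: "cyclically P w \<longleftrightarrow> list_all2 P w (rotate1 w)"
  by (simp add: cyclically_def cyclic_pairs_def list_all2_iff)

lemma cyclically_rotate: "cyclically P (rotate k w) \<longleftrightarrow> cyclically P w"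
  by (simp add: cyclically_def cyclic_pairs_rotate)

lemma cyclically_word_pow: "m > 0 \<Longrightarrow> cyclically P (word_pow w m) \<longleftrightarrow> cyclically P w"
  by (simp add: cyclically_def cyclic_pairs_word_pow set_word_pow)

section \<open>Traces of powers and the determinant\<close>

definition mat_trace :: "'a::comm_monoid_add mat \<Rightarrow> 'a" where
  "mat_trace A = (\<Sum>i<dim_row A. A $$ (i, i))"

lemma index_mult_mat_sum:
  assumes "A \<in> carrier_mat n m" "B \<in> carrier_mat m k" "i < n" "j < k"
  shows "(A * B) $$ (i, j) = (\<Sum>l<m. A $$ (i, l) * B $$ (l, j))"
  using assms by (auto simp: scalar_prod_def lessThan_atLeast0)

lemma index_mult_mat_vec_sum:
  assumes "A \<in> carrier_mat n m" "v \<in> carrier_vec m" "i < n"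
  shows "vec_index (A *\<^sub>v v) i = (\<Sum>l<m. A $$ (i, l) * vec_index v l)"
  using assms by (auto simp: scalar_prod_def lessThan_atLeast0)

lemma pow_mat_Suc_left:
  fixes A :: "'a::semiring_1 mat"
  assumes A: "A \<in> carrier_mat n n"
  shows "A ^\<^sub>m Suc k = A * A ^\<^sub>m k"
proof (induction k)
  case (Suc k)
  have "A ^\<^sub>m Suc (Suc k) = (A * A ^\<^sub>m k) * A" using Suc by simp
  also have "\<dots> = A * (A ^\<^sub>m k * A)" by (rule assoc_mult_mat[of _ n n _ n _ n]) (use A in auto)
  finally show ?case by simp
qed (use A in simp)

lemma row_sum_pow_mat_Suc:
  fixes A :: "'a::semiring_1 mat"
  assumes A: "A \<in> carrier_mat n n" and i: "i < n"
  shows "(\<Sum>j<n. (A ^\<^sub>m Suc k) $$ (i, j)) = (\<Sum>l<n. A $$ (i, l) * (\<Sum>j<n. (A ^\<^sub>m k) $$ (l, j)))"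
proof -
  have "(\<Sum>j<n. (A ^\<^sub>m Suc k) $$ (i, j)) = (\<Sum>j<n. \<Sum>l<n. A $$ (i, l) * (A ^\<^sub>m k) $$ (l, j))"
    unfolding pow_mat_Suc_left[OF A]
    using i by (intro sum.cong refl index_mult_mat_sum[OF A pow_carrier_mat[OF A]]) auto
  also have "\<dots> = (\<Sum>l<n. \<Sum>j<n. A $$ (i, l) * (A ^\<^sub>m k) $$ (l, j))" by (rule sum.swap)
  finally show ?thesis by (simp add: sum_distrib_left)
qed

lemma mat_trace_mult_commute:
  fixes A B :: "'a::comm_semiring_0 mat"
  assumes A: "A \<in> carrier_mat n m" and B: "B \<in> carrier_mat m n"
  shows "mat_trace (A * B) = mat_trace (B * A)"
proof -
  have "mat_trace (A * B) = (\<Sum>i<n. \<Sum>l<m. A $$ (i, l) * B $$ (l, i))"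
    using A B by (simp add: mat_trace_def index_mult_mat_sum[OF A B] del: index_mult_mat(1))
  also have "\<dots> = (\<Sum>l<m. \<Sum>i<n. B $$ (l, i) * A $$ (i, l))"
    by (subst sum.swap) (simp add: mult.commute)
  also have "\<dots> = mat_trace (B * A)"
    using A B by (simp add: mat_trace_def index_mult_mat_sum[OF B A] del: index_mult_mat(1))
  finally show ?thesis .
qed

lemma mat_trace_similar:
  fixes A B :: "'a::comm_ring_1 mat"
  assumes A: "A \<in> carrier_mat n n" and wit: "similar_mat_wit A B P Q"
  shows "mat_trace A = mat_trace B"
proof -
  note wit_facts = similar_mat_witD2[OF A wit]
  have "mat_trace A = mat_trace (P * (B * Q))"
    unfolding wit_facts(3) assoc_mult_mat[OF wit_facts(6,5,7)] ..
  also have "\<dots> = mat_trace (B * Q * P)"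
    using wit_facts(5-7) by (intro mat_trace_mult_commute[of _ n n]) auto
  also have "B * Q * P = B"
    unfolding assoc_mult_mat[OF wit_facts(5,7,6)] wit_facts(2) using wit_facts(5) by simp
  finally show ?thesis .
qed

lemma index_mult_upper_triangular:
  fixes A B :: "'a::semiring_0 mat"
  assumes "A \<in> carrier_mat n n" "B \<in> carrier_mat n n"
    and "upper_triangular A" "upper_triangular B" and "i < n" "j \<le> i"
  shows "(A * B) $$ (i, j) = (if i = j then A $$ (i, i) * B $$ (i, i) else 0)"
proof -
  have "A $$ (i, l) * B $$ (l, j)
      = (if l = i then (if i = j then A $$ (i, i) * B $$ (i, i) else 0) else 0)"
    if "l < n" for l
    using assms that by (cases l i rule: linorder_cases) (auto simp: upper_triangularD)
  then show ?thesis
    using assms index_mult_mat_sum[OF assms(1,2), of i j] by (simp add: sum.delta)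
qed

lemma upper_triangular_pow:
  fixes B :: "'a::comm_semiring_1 mat"
  assumes B: "B \<in> carrier_mat n n" and ut: "upper_triangular B"
  shows "upper_triangular (B ^\<^sub>m k)"
    and "i < n \<Longrightarrow> (B ^\<^sub>m k) $$ (i, i) = (B $$ (i, i)) ^ k"
proof -
  have "upper_triangular (B ^\<^sub>m k) \<and> (\<forall>i<n. (B ^\<^sub>m k) $$ (i, i) = (B $$ (i, i)) ^ k)"
  proof (induction k)
    case (Suc k)
    then show ?case
      using B ut index_mult_upper_triangular[OF pow_carrier_mat[OF B] B]
      by (auto simp: upper_triangular_def mult.commute)
  qed (use B in simp)
  then show "upper_triangular (B ^\<^sub>m k)" "i < n \<Longrightarrow> (B ^\<^sub>m k) $$ (i, i) = (B $$ (i, i)) ^ k"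
    by auto
qed

lemma similar_mat_one_minus:
  fixes A B :: "'a::comm_ring_1 mat"
  assumes A: "A \<in> carrier_mat n n" and wit: "similar_mat_wit A B P Q"
  shows "similar_mat (1\<^sub>m n - A) (1\<^sub>m n - B)"
proof -
  note wit_facts = similar_mat_witD2[OF A wit]
  have "P * (1\<^sub>m n - B) * Q = P * Q - P * B * Q"
    using wit_facts(5-7)
    by (simp add: mult_minus_distrib_mat[of P n n _ n] minus_mult_distrib_mat[of _ n n _ _ n])
  then have "P * (1\<^sub>m n - B) * Q = 1\<^sub>m n - A" unfolding wit_facts(1) wit_facts(3)[symmetric] .
  then have "similar_mat_wit (1\<^sub>m n - A) (1\<^sub>m n - B) P Q"
    using wit_facts(1,2,4-7) by (intro similar_mat_witI[of _ _ n]) auto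
  then show ?thesis by (auto simp: similar_mat_def)
qed

lemma trace_pow_and_det_via_eigenvalues:
  fixes C :: "complex mat"
  assumes C: "C \<in> carrier_mat n n"
  obtains es where "\<And>k. mat_trace (C ^\<^sub>m k) = (\<Sum>e\<leftarrow>es. e ^ k)"
    and "det (1\<^sub>m n - C) = (\<Prod>e\<leftarrow>es. 1 - e)"
    and "set es \<subseteq> spectrum C"
proof -
  obtain es where es: "char_poly C = (\<Prod>e\<leftarrow>es. [:- e, 1:])"
    using char_poly_factorized[OF C] by blast
  obtain B P Q where "schur_decomposition C es = (B, P, Q)"
    by (cases "schur_decomposition C es") auto
  from schur_decomposition[OF C es this]
  have sim: "similar_mat_wit C B P Q" and ut: "upper_triangular B" and diag: "diag_mat B = es"
    by auto
  have B: "B \<in> carrier_mat n n" using similar_mat_witD2[OF C sim] by simp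
  have "mat_trace (C ^\<^sub>m k) = (\<Sum>e\<leftarrow>es. e ^ k)" for k
  proof -
    have "mat_trace (C ^\<^sub>m k) = mat_trace (B ^\<^sub>m k)"
      by (rule mat_trace_similar[OF pow_carrier_mat[OF C] similar_mat_wit_pow[OF sim]])
    also have "\<dots> = (\<Sum>i<n. (B $$ (i, i)) ^ k)"
      using B by (simp add: mat_trace_def upper_triangular_pow(2)[OF B ut])
    also have "\<dots> = (\<Sum>e\<leftarrow>es. e ^ k)"
      using B by (simp add: diag[symmetric] diag_mat_def comp_def sum_list_sum_nth lessThan_atLeast0)
    finally show ?thesis .
  qed
  moreover have "det (1\<^sub>m n - C) = (\<Prod>e\<leftarrow>es. 1 - e)"
  proof -
    have "det (1\<^sub>m n - C) = det (1\<^sub>m n - B)"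
      by (rule det_similar[OF similar_mat_one_minus[OF C sim]])
    also have "\<dots> = prod_list (diag_mat (1\<^sub>m n - B))"
      using B ut by (intro det_upper_triangular) (auto simp: upper_triangular_def)
    also have "diag_mat (1\<^sub>m n - B) = map (\<lambda>e. 1 - e) es"
      using B by (auto simp: diag[symmetric] diag_mat_def)
    finally show ?thesis .
  qed
  moreover have "set es \<subseteq> spectrum C"
    unfolding spectrum_root_char_poly[OF C] es by (auto simp: poly_prod_list prod_list_zero_iff)
  ultimately show ?thesis by (rule that)
qed

lemma sums_sum_list:
  fixes f :: "'a \<Rightarrow> nat \<Rightarrow> 'b::{topological_comm_monoid_add,t2_space}"
  assumes "\<And>x. x \<in> set xs \<Longrightarrow> f x sums s x"
  shows "(\<lambda>k. \<Sum>x\<leftarrow>xs. f x k) sums (\<Sum>x\<leftarrow>xs. s x)"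
  using assms by (induction xs) (auto intro: sums_add)

lemma exp_sum_list:
  fixes f :: "'a \<Rightarrow> 'b::{real_normed_field,banach}"
  shows "exp (\<Sum>x\<leftarrow>xs. f x) = (\<Prod>x\<leftarrow>xs. exp (f x))"
  by (induction xs) (auto simp: exp_add)

lemma neg_Ln_one_minus_sums:
  fixes z :: complex
  assumes "cmod z < 1"
  shows "(\<lambda>k. z ^ k / of_nat k) sums (- Ln (1 - z))"
  using sums_minus[OF Ln_series'[of "- z"]] assms by simp

lemma exp_neg_Ln_one_minus:
  fixes z :: complex
  assumes "cmod z < 1"
  shows "exp (- Ln (1 - z)) = inverse (1 - z)"
proof -
  have "1 - z \<noteq> 0" using assms by auto
  then show ?thesis by (simp add: exp_minus)
qed

lemma trace_log_sums:
  fixes C :: "complex mat"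
  assumes C: "C \<in> carrier_mat n n" and spec: "spectrum C \<subseteq> ball 0 1"
  obtains L where "(\<lambda>k. mat_trace (C ^\<^sub>m Suc k) / of_nat (Suc k)) sums L"
    and "exp L = inverse (det (1\<^sub>m n - C))"
proof -
  obtain es where tr: "\<And>k. mat_trace (C ^\<^sub>m k) = (\<Sum>e\<leftarrow>es. e ^ k)"
    and det: "det (1\<^sub>m n - C) = (\<Prod>e\<leftarrow>es. 1 - e)" and "set es \<subseteq> spectrum C"
    using trace_pow_and_det_via_eigenvalues[OF C] by blast
  then have lt: "cmod e < 1" if "e \<in> set es" for e using that spec by auto
  define L where "L = (\<Sum>e\<leftarrow>es. - Ln (1 - e))"
  have "(\<lambda>k. \<Sum>e\<leftarrow>es. e ^ k / of_nat k) sums L"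
    unfolding L_def by (intro sums_sum_list neg_Ln_one_minus_sums lt)
  moreover have "(\<Sum>e\<leftarrow>es. e ^ k / of_nat k) = mat_trace (C ^\<^sub>m k) / of_nat k" for k
    by (simp add: tr divide_inverse sum_list_mult_const)
  ultimately have "(\<lambda>k. mat_trace (C ^\<^sub>m k) / of_nat k) sums L" by simp
  then have "(\<lambda>k. mat_trace (C ^\<^sub>m Suc k) / of_nat (Suc k)) sums L"
    by (subst sums_Suc_iff) simp
  moreover have "exp L = inverse (det (1\<^sub>m n - C))"
  proof -
    have "exp L = (\<Prod>e\<leftarrow>es. exp (- Ln (1 - e)))"
      unfolding L_def by (rule exp_sum_list)
    also have "\<dots> = (\<Prod>e\<leftarrow>es. inverse (1 - e))"
      using lt by (intro arg_cong[of _ _ prod_list] map_cong) (auto simp: exp_neg_Ln_one_minus)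
    also have "\<dots> = inverse (\<Prod>e\<leftarrow>es. 1 - e)" by (induction es) auto
    finally show ?thesis by (simp add: det)
  qed
  ultimately show ?thesis by (rule that)
qed

section \<open>Matrices whose spectrum lies in the open unit disc\<close>

lemma spectrum_subset_ball_if_spectral_radius_less:
  assumes C: "C \<in> carrier_mat n n" and "spectral_radius C < r"
  shows "spectrum C \<subseteq> ball 0 r"
proof
  fix e assume e: "e \<in> spectrum C"
  then have "n > 0" using eigenvalue_imp_nonzero_dim[OF C] by (simp add: spectrum_def)
  then have "cmod e \<le> spectral_radius C" using e by (intro spectral_radius_mem_max(2)[OF C]) auto
  then show "e \<in> ball 0 r" using assms(2) by simp
qed

lemma norm_eigenvalue_mult_norm_le:
  fixes C :: "'a::real_normed_field mat"
  assumes C: "C \<in> carrier_mat n n" and z: "z \<in> carrier_vec n" "C *\<^sub>v z = e \<cdot>\<^sub>v z" and i: "i < n"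
  shows "norm e * norm (vec_index z i) \<le> (\<Sum>j<n. norm (C $$ (i, j)) * norm (vec_index z j))"
proof -
  have "e * vec_index z i = (\<Sum>j<n. C $$ (i, j) * vec_index z j)"
    using index_mult_mat_vec_sum[OF C z(1) i] z i by simp
  then have "norm e * norm (vec_index z i) = norm (\<Sum>j<n. C $$ (i, j) * vec_index z j)"
    by (metis norm_mult)
  also have "\<dots> \<le> (\<Sum>j<n. norm (C $$ (i, j) * vec_index z j))" by (rule norm_sum)
  finally show ?thesis by (simp add: norm_mult)
qed

definition strictly_subinvariant ::
  "'a set \<Rightarrow> ('a \<Rightarrow> real) \<Rightarrow> ('a \<Rightarrow> 'a \<Rightarrow> 'b::real_normed_vector) \<Rightarrow> bool" where
  "strictly_subinvariant S v M \<longleftrightarrow> (\<forall>b\<in>S. v b > 0 \<and> (\<Sum>a\<in>S. v a * norm (M a b)) < v b)"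

lemma spectrum_subset_ball_if_strictly_subinvariant:
  fixes C :: "complex mat"
  assumes C: "C \<in> carrier_mat n n"
    and sub: "strictly_subinvariant {..<n} v (\<lambda>i j. C $$ (i, j))"
  shows "spectrum C \<subseteq> ball 0 1"
proof
  have v: "v i > 0" and col: "(\<Sum>j<n. v j * cmod (C $$ (j, i))) < v i" if "i < n" for i
    using sub that by (auto simp: strictly_subinvariant_def)
  fix e assume "e \<in> spectrum C"
  then obtain z where z: "z \<in> carrier_vec n" "z \<noteq> 0\<^sub>v n" "C *\<^sub>v z = e \<cdot>\<^sub>v z"
    using C by (auto simp: spectrum_def eigenvalue_def eigenvector_def)
  obtain i\<^sub>0 where i\<^sub>0: "i\<^sub>0 < n" "vec_index z i\<^sub>0 \<noteq> 0" using z(1,2) eq_vecI[of z "0\<^sub>v n"] by auto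
  define S where "S = (\<Sum>i<n. v i * cmod (vec_index z i))"
  have "S > 0" unfolding S_def
    by (rule sum_pos2[of _ i\<^sub>0]) (use v i\<^sub>0 in \<open>auto simp: less_imp_le\<close>)
  have "cmod e * S = (\<Sum>i<n. v i * (cmod e * cmod (vec_index z i)))"
    by (simp add: S_def sum_distrib_left mult_ac)
  also have "\<dots> \<le> (\<Sum>i<n. v i * (\<Sum>j<n. cmod (C $$ (i, j)) * cmod (vec_index z j)))"
    using v norm_eigenvalue_mult_norm_le[OF C z(1,3)]
    by (intro sum_mono mult_left_mono) (auto intro: less_imp_le)
  also have "\<dots> = (\<Sum>j<n. (\<Sum>i<n. v i * cmod (C $$ (i, j))) * cmod (vec_index z j))"
    by (simp add: sum_distrib_left sum_distrib_right mult_ac) (rule sum.swap)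
  also have "\<dots> < S" unfolding S_def
  proof (rule sum_strict_mono_ex1)
    show "\<forall>j\<in>{..<n}. (\<Sum>i<n. v i * cmod (C $$ (i, j))) * cmod (vec_index z j)
        \<le> v j * cmod (vec_index z j)"
      using less_imp_le[OF col] by (auto intro!: mult_right_mono)
    show "\<exists>j\<in>{..<n}. (\<Sum>i<n. v i * cmod (C $$ (i, j))) * cmod (vec_index z j)
        < v j * cmod (vec_index z j)"
      using col i\<^sub>0 by (intro bexI[of _ i\<^sub>0] mult_strict_right_mono) auto
  qed simp
  finally show "e \<in> ball 0 1" using \<open>S > 0\<close> by simp
qed

lemma spectrum_smult_subset:
  fixes A :: "'a::field mat"
  assumes A: "A \<in> carrier_mat n n" and "c \<noteq> 0"
  shows "spectrum (c \<cdot>\<^sub>m A) \<subseteq> (\<lambda>e. c * e) ` spectrum A"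
proof
  fix e assume "e \<in> spectrum (c \<cdot>\<^sub>m A)"
  then obtain z where z: "z \<in> carrier_vec n" "z \<noteq> 0\<^sub>v n" "(c \<cdot>\<^sub>m A) *\<^sub>v z = e \<cdot>\<^sub>v z"
    using A by (auto simp: spectrum_def eigenvalue_def eigenvector_def)
  have "A *\<^sub>v z = (e / c) \<cdot>\<^sub>v z"
  proof (rule eq_vecI)
    fix i assume "i < dim_vec ((e / c) \<cdot>\<^sub>v z)"
    then have i: "i < n" using z(1) by simp
    have "e * vec_index z i = c * vec_index (A *\<^sub>v z) i"
      using arg_cong[OF z(3), of "\<lambda>w. vec_index w i"] A z(1) i by simp
    then show "vec_index (A *\<^sub>v z) i = vec_index ((e / c) \<cdot>\<^sub>v z) i"
      using \<open>c \<noteq> 0\<close> i z(1) by (simp add: field_simps)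
  qed (use A z in simp)
  then have "e / c \<in> spectrum A"
    using A z(1,2) by (auto simp: spectrum_def eigenvalue_def eigenvector_def)
  then show "e \<in> (\<lambda>e. c * e) ` spectrum A"
    using \<open>c \<noteq> 0\<close> by (intro rev_image_eqI[of "e / c"]) auto
qed

lemma pow_smult_mat:
  fixes A :: "'a::comm_semiring_1 mat"
  assumes A: "A \<in> carrier_mat n n"
  shows "(c \<cdot>\<^sub>m A) ^\<^sub>m k = c ^ k \<cdot>\<^sub>m (A ^\<^sub>m k)"
proof (induction k)
  case (Suc k)
  have Ak: "A ^\<^sub>m k \<in> carrier_mat n n" and cA: "c \<cdot>\<^sub>m A \<in> carrier_mat n n" using A by simp_all
  have "(c \<cdot>\<^sub>m A) ^\<^sub>m Suc k = (c ^ k \<cdot>\<^sub>m (A ^\<^sub>m k)) * (c \<cdot>\<^sub>m A)" using Suc by simp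
  also have "\<dots> = c ^ k \<cdot>\<^sub>m (c \<cdot>\<^sub>m (A ^\<^sub>m k * A))"
    unfolding mult_smult_assoc_mat[OF Ak cA] mult_smult_distrib[OF Ak A] ..
  also have "\<dots> = c ^ Suc k \<cdot>\<^sub>m (A ^\<^sub>m Suc k)"
    by (rule eq_matI) (simp_all add: mult_ac)
  finally show ?case .
qed (use A in \<open>auto intro!: eq_matI\<close>)

lemma pow_mat_norm_bounded:
  assumes C: "C \<in> carrier_mat n n" and spec: "spectrum C \<subseteq> ball 0 1"
  obtains b where "\<And>k i j. i < n \<Longrightarrow> j < n \<Longrightarrow> cmod ((C ^\<^sub>m k) $$ (i, j)) \<le> b"
proof (cases "n = 0")
  case False
  then have "spectral_radius C \<in> norm ` spectrum C"
    by (intro spectral_radius_mem_max(1)[OF C]) simp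
  then have "spectral_radius C < 1" using spec by auto
  then obtain b where "\<forall>k. norm_bound (C ^\<^sub>m k) b"
    using spectral_radius_jnf_norm_bound_less_1_upper_triangular[OF C] by blast
  then show ?thesis using that[of b] C by (simp add: norm_bound_def)
qed (use that in simp)

lemma pow_mat_geometric_bound:
  assumes C: "C \<in> carrier_mat n n" and spec: "spectrum C \<subseteq> ball 0 1"
  obtains b s where "0 < s" "s < 1"
    and "\<And>k i j. i < n \<Longrightarrow> j < n \<Longrightarrow> cmod ((C ^\<^sub>m k) $$ (i, j)) \<le> b * s ^ k"
proof -
  have fin: "finite (spectrum C)" using card_finite_spectrum[OF C] by simp
  have "Max (insert 0 (cmod ` spectrum C)) < 1"
    using spec fin by (subst Max_less_iff) auto
  then obtain s where s: "Max (insert 0 (cmod ` spectrum C)) < s" "s < 1"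
    using dense by blast
  then have "0 < s" and lt: "\<And>e. e \<in> spectrum C \<Longrightarrow> cmod e < s"
    using fin by (simp_all add: Max_less_iff)
  define c where "c = complex_of_real (1 / s)"
  have "c \<noteq> 0" using \<open>0 < s\<close> by (simp add: c_def)
  have "spectrum (c \<cdot>\<^sub>m C) \<subseteq> ball 0 1"
    using spectrum_smult_subset[OF C \<open>c \<noteq> 0\<close>] lt \<open>0 < s\<close>
    by (force simp: c_def norm_mult norm_divide divide_less_eq)
  then obtain b where b: "\<And>k i j. i < n \<Longrightarrow> j < n \<Longrightarrow> cmod (((c \<cdot>\<^sub>m C) ^\<^sub>m k) $$ (i, j)) \<le> b"
    using pow_mat_norm_bounded[of "c \<cdot>\<^sub>m C" n] C by auto
  have "cmod ((C ^\<^sub>m k) $$ (i, j)) \<le> b * s ^ k" if "i < n" "j < n" for k i j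
  proof -
    have "cmod (((c \<cdot>\<^sub>m C) ^\<^sub>m k) $$ (i, j)) = cmod ((C ^\<^sub>m k) $$ (i, j)) / s ^ k"
      using C that \<open>0 < s\<close>
      by (simp add: pow_smult_mat[OF C] c_def norm_mult norm_power norm_divide power_divide)
    then show ?thesis using b[OF that, of k] \<open>0 < s\<close> by (simp add: divide_le_eq)
  qed
  with \<open>0 < s\<close> s(2) show ?thesis by (rule that)
qed

lemma summable_norm_pow_mat:
  assumes C: "C \<in> carrier_mat n n" and spec: "spectrum C \<subseteq> ball 0 1" and ij: "i < n" "j < n"
  shows "summable (\<lambda>k. cmod ((C ^\<^sub>m k) $$ (i, j)))"
proof -
  obtain b s where s: "0 < s" "s < 1"
    and bound: "\<And>k i j. i < n \<Longrightarrow> j < n \<Longrightarrow> cmod ((C ^\<^sub>m k) $$ (i, j)) \<le> b * s ^ k"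
    by (rule pow_mat_geometric_bound[OF C spec]) (rule that)
  show ?thesis
  proof (rule summable_comparison_test')
    show "summable (\<lambda>k. b * s ^ k)" using s by (simp add: summable_mult summable_geometric)
    show "norm (cmod ((C ^\<^sub>m k) $$ (i, j))) \<le> b * s ^ k" for k using bound[OF ij] by simp
  qed
qed

section \<open>Matrices indexed by finite sets\<close>

definition indexed_mat :: "'a list \<Rightarrow> 'b list \<Rightarrow> ('a \<Rightarrow> 'b \<Rightarrow> 'c) \<Rightarrow> 'c mat" where
  "indexed_mat xs ys M = mat (length xs) (length ys) (\<lambda>(i, j). M (xs ! i) (ys ! j))"

lemma indexed_mat_carrier [simp]: "indexed_mat xs ys M \<in> carrier_mat (length xs) (length ys)"
  by (simp add: indexed_mat_def)

lemma dim_indexed_mat [simp]: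
  "dim_row (indexed_mat xs ys M) = length xs" "dim_col (indexed_mat xs ys M) = length ys"
  by (simp_all add: indexed_mat_def)

lemma index_indexed_mat [simp]:
  "i < length xs \<Longrightarrow> j < length ys \<Longrightarrow> indexed_mat xs ys M $$ (i, j) = M (xs ! i) (ys ! j)"
  by (simp add: indexed_mat_def)

lemma indexed_mat_cong:
  assumes "\<And>x y. x \<in> set xs \<Longrightarrow> y \<in> set ys \<Longrightarrow> M x y = N x y"
  shows "indexed_mat xs ys M = indexed_mat xs ys N"
  using assms by (intro eq_matI) auto

lemma indexed_mat_append:
  "indexed_mat (xs @ xs') (ys @ ys') M = four_block_mat (indexed_mat xs ys M) (indexed_mat xs ys' M)
    (indexed_mat xs' ys M) (indexed_mat xs' ys' M)"
  by (rule eq_matI) (auto simp: nth_append)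

lemma minus_indexed_mat:
  "indexed_mat xs ys M - indexed_mat xs ys N = indexed_mat xs ys (\<lambda>x y. M x y - N x y)"
  by (rule eq_matI) auto

lemma one_mat_eq_indexed_mat:
  "distinct xs \<Longrightarrow> 1\<^sub>m (length xs) = indexed_mat xs xs (\<lambda>x y. if x = y then 1 else 0)"
  by (rule eq_matI) (auto simp: nth_eq_iff_index_eq)

lemma sum_nth_eq_sum_set: "distinct xs \<Longrightarrow> (\<Sum>i<length xs. f (xs ! i)) = sum f (set xs)"
  by (rule sum.reindex_bij_betw[OF bij_betw_nth]) auto

lemma mult_indexed_mat:
  assumes "distinct ys"
  shows "indexed_mat xs ys M * indexed_mat ys zs N
    = indexed_mat xs zs (\<lambda>x z. \<Sum>y\<in>set ys. M x y * N y z)"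
  using assms
  by (intro eq_matI)
    (simp_all add: index_mult_mat_sum[of _ "length xs" "length ys" _ "length zs"]
      sum_nth_eq_sum_set[symmetric] del: index_mult_mat(1))

lemma mat_trace_indexed_mat:
  "distinct xs \<Longrightarrow> mat_trace (indexed_mat xs xs M) = (\<Sum>x\<in>set xs. M x x)"
  by (simp add: mat_trace_def sum_nth_eq_sum_set[symmetric])

lemma det_indexed_mat_diagonal:
  assumes "distinct xs"
  shows "det (indexed_mat xs xs (\<lambda>x y. if x = y then d x else 0)) = (\<Prod>x\<in>set xs. d x)"
proof -
  let ?D = "indexed_mat xs xs (\<lambda>x y. if x = y then d x else 0)"
  have "det ?D = prod_list (diag_mat ?D)"
    using assms by (intro det_upper_triangular[of _ "length xs"]) (auto simp: nth_eq_iff_index_eq)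
  also have "diag_mat ?D = map d xs"
    by (rule nth_equalityI) (auto simp: diag_mat_def)
  finally show ?thesis using assms by (simp add: prod.distinct_set_conv_list)
qed

lemma det_scale_rows_indexed_mat:
  fixes M :: "'a \<Rightarrow> 'a \<Rightarrow> 'b::comm_ring_1"
  assumes "distinct xs"
  shows "det (indexed_mat xs xs (\<lambda>x y. d x * M x y)) = (\<Prod>x\<in>set xs. d x) * det (indexed_mat xs xs M)"
proof -
  have "indexed_mat xs xs (\<lambda>x y. d x * M x y)
      = indexed_mat xs xs (\<lambda>x y. if x = y then d x else 0) * indexed_mat xs xs M"
    unfolding mult_indexed_mat[OF assms]
    by (rule indexed_mat_cong) (simp add: if_distrib[of "\<lambda>t. t * _"] sum.delta cong: if_cong)
  also have "det \<dots> = det (indexed_mat xs xs (\<lambda>x y. if x = y then d x else 0))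
      * det (indexed_mat xs xs M)"
    by (rule det_mult[of _ "length xs"]) simp_all
  finally show ?thesis by (simp only: det_indexed_mat_diagonal[OF assms])
qed

section \<open>The sum over cyclic words\<close>

abbreviation words :: "'a set \<Rightarrow> nat \<Rightarrow> 'a list set" where
  "words S k \<equiv> {w. set w \<subseteq> S \<and> length w = k}"

lemma sum_words_Suc: "(\<Sum>w\<in>words S (Suc k). f w) = (\<Sum>a\<in>S. \<Sum>w\<in>words S k. f (a # w))"
proof -
  have "words S (Suc k) = (\<lambda>(a, w). a # w) ` (S \<times> words S k)"
    by (auto simp: length_Suc_conv image_iff)
  moreover have "inj_on (\<lambda>(a, w). a # w) (S \<times> words S k)"
    by (auto intro: inj_onI)
  ultimately show ?thesis
    by (simp add: sum.reindex sum.cartesian_product case_prod_unfold)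
qed

lemma pow_indexed_mat_path_sum:
  fixes M :: "'a \<Rightarrow> 'a \<Rightarrow> 'b::semiring_1"
  assumes xs: "distinct xs"
  shows "indexed_mat xs xs M ^\<^sub>m Suc k
    = indexed_mat xs xs (\<lambda>a b. \<Sum>w\<in>words (set xs) k. \<Prod>(c, d)\<leftarrow>zip (a # w) (w @ [b]). M c d)"
proof (induction k)
  case 0
  have "words (set xs) 0 = {[]}" by auto
  then show ?case by simp
next
  case (Suc k)
  show ?case
    unfolding pow_mat_Suc_left[OF indexed_mat_carrier, of _ _ "Suc k"] Suc mult_indexed_mat[OF xs]
      sum_words_Suc
    by (simp add: sum_distrib_left)
qed

lemma mat_trace_pow_indexed_mat:
  fixes M :: "'a \<Rightarrow> 'a \<Rightarrow> 'b::semiring_1"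
  assumes xs: "distinct xs"
  shows "mat_trace (indexed_mat xs xs M ^\<^sub>m Suc k) = (\<Sum>w\<in>words (set xs) (Suc k). cyclic_weight M w)"
  unfolding pow_indexed_mat_path_sum[OF xs] mat_trace_indexed_mat[OF xs] sum_words_Suc
  by (simp add: cyclic_weight_def cyclic_pairs_def)

lemma bij_betw_snd_words: "bij_betw snd (SIGMA k:UNIV. words S (Suc k)) (lists S - {[]})"
proof (rule bij_betw_byWitness[where f' = "\<lambda>w. (length w - 1, w)"])
  show "(\<lambda>w. (length w - 1, w)) ` (lists S - {[]}) \<subseteq> (SIGMA k:UNIV. words S (Suc k))"
    by (auto simp: neq_Nil_conv)
qed auto

lemma words_abs_summable:
  fixes f :: "'a list \<Rightarrow> 'b::real_normed_vector"
  assumes S: "finite S" and sum: "summable (\<lambda>k. \<Sum>w\<in>words S (Suc k). norm (f w))"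
  shows "f abs_summable_on (lists S - {[]})"
proof -
  have "(\<lambda>(k, w). norm (f w)) summable_on (SIGMA k:UNIV. words S (Suc k))"
  proof (rule summable_on_SigmaI)
    show "(\<lambda>k. \<Sum>w\<in>words S (Suc k). norm (f w)) summable_on UNIV"
      using sum by (simp add: summable_on_UNIV_nonneg_real_iff sum_nonneg)
  qed (simp_all add: has_sum_finite finite_lists_length_eq[OF S])
  then show ?thesis
    using summable_on_reindex_bij_betw[OF bij_betw_snd_words, of "\<lambda>w. norm (f w)" S]
    by (simp add: case_prod_unfold)
qed

lemma words_has_sum:
  fixes f :: "'a list \<Rightarrow> 'b::banach"
  assumes S: "finite S" and abs: "f abs_summable_on (lists S - {[]})"
    and L: "(\<lambda>k. \<Sum>w\<in>words S (Suc k). f w) sums L"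
  shows "(f has_sum L) (lists S - {[]})"
proof -
  obtain T where T: "(f has_sum T) (lists S - {[]})"
    using abs_summable_summable[OF abs] by (auto simp: summable_on_def)
  then have "((\<lambda>(k, w). f w) has_sum T) (SIGMA k:UNIV. words S (Suc k))"
    using has_sum_reindex_bij_betw[OF bij_betw_snd_words, of f S T] by (simp add: case_prod_unfold)
  then have "((\<lambda>k. \<Sum>w\<in>words S (Suc k). f w) has_sum T) UNIV"
    by (rule has_sum_SigmaD) (simp add: has_sum_finite finite_lists_length_eq[OF S])
  then have "T = L" using L has_sum_imp_sums sums_unique2 by blast
  then show ?thesis using T by simp
qed

lemma of_real_norm_cyclic_weight:
  fixes M :: "'a \<Rightarrow> 'a \<Rightarrow> 'b::{real_normed_div_algebra,comm_ring_1}"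
  shows "of_real (norm (cyclic_weight M w)) = cyclic_weight (\<lambda>a b. of_real (norm (M a b)) :: 'b) w"
proof -
  have "of_real (norm (\<Prod>(a, b)\<leftarrow>ps. M a b)) = (\<Prod>(a, b)\<leftarrow>ps. of_real (norm (M a b)) :: 'b)" for ps
    by (induction ps) (auto simp: norm_mult)
  then show ?thesis by (simp add: cyclic_weight_def)
qed

lemma spectrum_indexed_mat_subset_ball:
  fixes M :: "'a \<Rightarrow> 'a \<Rightarrow> complex"
  assumes xs: "distinct xs" and sub: "strictly_subinvariant (set xs) v M"
  shows "spectrum (indexed_mat xs xs M) \<subseteq> ball 0 1"
proof (rule spectrum_subset_ball_if_strictly_subinvariant[OF indexed_mat_carrier])
  have "(\<Sum>i<length xs. v (xs ! i) * cmod (indexed_mat xs xs M $$ (i, j)))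
      = (\<Sum>a\<in>set xs. v a * cmod (M a (xs ! j)))" if "j < length xs" for j
    using that by (simp add: sum_nth_eq_sum_set[OF xs, symmetric])
  then show "strictly_subinvariant {..<length xs} (\<lambda>i. v (xs ! i))
      (\<lambda>i j. indexed_mat xs xs M $$ (i, j))"
    using sub by (simp add: strictly_subinvariant_def)
qed

lemma summable_sum_norm_cyclic_weight:
  fixes M :: "'a \<Rightarrow> 'a \<Rightarrow> complex"
  assumes xs: "distinct xs" and sub: "strictly_subinvariant (set xs) v M"
  shows "summable (\<lambda>k. \<Sum>w\<in>words (set xs) (Suc k). cmod (cyclic_weight M w))"
proof -
  define N where "N = indexed_mat xs xs (\<lambda>a b. complex_of_real (cmod (M a b)))"
  have N: "N \<in> carrier_mat (length xs) (length xs)" by (simp add: N_def)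
  have spec: "spectrum N \<subseteq> ball 0 1"
    unfolding N_def using sub
    by (intro spectrum_indexed_mat_subset_ball[OF xs, of v]) (simp add: strictly_subinvariant_def)
  show ?thesis
  proof (rule summable_comparison_test')
    have "summable (\<lambda>k. \<Sum>i<length xs. cmod ((N ^\<^sub>m k) $$ (i, i)))"
      by (intro summable_sum summable_norm_pow_mat[OF N spec]) auto
    then show "summable (\<lambda>k. \<Sum>i<length xs. cmod ((N ^\<^sub>m Suc k) $$ (i, i)))"
      by (subst summable_Suc_iff)
    fix k
    have "(\<Sum>w\<in>words (set xs) (Suc k). cmod (cyclic_weight M w))
        = cmod (complex_of_real (\<Sum>w\<in>words (set xs) (Suc k). cmod (cyclic_weight M w)))"
      by (simp only: norm_of_real abs_of_nonneg sum_nonneg norm_ge_zero)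
    also have "\<dots> = cmod (mat_trace (N ^\<^sub>m Suc k))"
      unfolding N_def mat_trace_pow_indexed_mat[OF xs] of_real_sum of_real_norm_cyclic_weight ..
    also have "\<dots> \<le> (\<Sum>i<length xs. cmod ((N ^\<^sub>m Suc k) $$ (i, i)))"
      using N by (simp add: mat_trace_def norm_sum del: pow_mat.simps)
    finally show "norm (\<Sum>w\<in>words (set xs) (Suc k). cmod (cyclic_weight M w))
        \<le> (\<Sum>i<length xs. cmod ((N ^\<^sub>m Suc k) $$ (i, i)))"
      by (simp add: sum_nonneg del: pow_mat.simps)
  qed
qed

abbreviation cyclic_log_sum :: "('a \<Rightarrow> 'a \<Rightarrow> complex) \<Rightarrow> 'a set \<Rightarrow> complex \<Rightarrow> bool" where
  "cyclic_log_sum M S L \<equiv>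
    ((\<lambda>w. cyclic_weight M w / of_nat (length w)) has_sum L) (lists S - {[]})"

lemma cyclic_log_sum_eq_log_det:
  assumes xs: "distinct xs" and sub: "strictly_subinvariant (set xs) v M"
  obtains L where "cyclic_log_sum M (set xs) L"
    and "exp L = inverse (det (1\<^sub>m (length xs) - indexed_mat xs xs M))"
proof -
  let ?f = "\<lambda>w. cyclic_weight M w / of_nat (length w)"
  obtain L where L: "(\<lambda>k. mat_trace (indexed_mat xs xs M ^\<^sub>m Suc k) / of_nat (Suc k)) sums L"
    and exp_L: "exp L = inverse (det (1\<^sub>m (length xs) - indexed_mat xs xs M))"
    using trace_log_sums[OF indexed_mat_carrier spectrum_indexed_mat_subset_ball[OF assms]] by blast
  have "mat_trace (indexed_mat xs xs M ^\<^sub>m Suc k) / of_nat (Suc k) = (\<Sum>w\<in>words (set xs) (Suc k). ?f w)"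
    for k
    unfolding mat_trace_pow_indexed_mat[OF xs] sum_divide_distrib by (rule sum.cong) auto
  with L have "(\<lambda>k. \<Sum>w\<in>words (set xs) (Suc k). ?f w) sums L" by simp
  moreover have "?f abs_summable_on (lists (set xs) - {[]})"
  proof (rule abs_summable_on_comparison_test)
    show "cyclic_weight M abs_summable_on (lists (set xs) - {[]})"
      by (rule words_abs_summable[OF _ summable_sum_norm_cyclic_weight[OF assms]]) auto
    fix w assume "w \<in> lists (set xs) - {[]}"
    then have "real (length w) \<ge> 1" by (auto simp: Suc_le_eq)
    then show "cmod (?f w) \<le> cmod (cyclic_weight M w)"
      by (simp add: norm_divide divide_le_eq mult_left_le mult_le_cancel_left1)
  qed
  ultimately have "(?f has_sum L) (lists (set xs) - {[]})"
    by (intro words_has_sum) auto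
  then show ?thesis using exp_L by (rule that)
qed

section \<open>The Euler product over primitive necklaces\<close>

lemma neg_Ln_one_minus_has_sum:
  fixes z :: complex
  assumes "cmod z < 1"
  shows "((\<lambda>m. z ^ m / of_nat m) has_sum (- Ln (1 - z))) {1..}"
proof -
  have "summable (\<lambda>m. norm (z ^ m / of_nat m))"
  proof (rule summable_comparison_test')
    show "summable (\<lambda>m. cmod z ^ m)" using assms by (simp add: summable_geometric)
    show "norm (norm (z ^ m / of_nat m)) \<le> cmod z ^ m" for m
      using mult_left_mono[of 1 "real m" "cmod z ^ m"]
      by (cases "m = 0") (simp_all add: norm_divide norm_power divide_le_eq)
  qed
  then have "((\<lambda>m. z ^ m / of_nat m) has_sum (- Ln (1 - z))) UNIV"
    using neg_Ln_one_minus_sums[OF assms] by (rule norm_summable_imp_has_sum)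
  then show ?thesis
    by (rule has_sum_cong_neutral[THEN iffD1, rotated -1]) auto
qed

lemma norm_less_one_if_log_series_summable:
  fixes z :: complex
  assumes "(\<lambda>m. z ^ m / of_nat m) summable_on {1..}"
  shows "cmod z < 1"
proof (rule ccontr)
  assume "\<not> cmod z < 1"
  then have z: "cmod z \<ge> 1" by simp
  have "(\<lambda>m. z ^ m / of_nat m) abs_summable_on {1..}"
    using assms by (simp add: summable_on_iff_abs_summable_on_complex)
  then have "(\<lambda>m. inverse (real m)) abs_summable_on {1..}"
  proof (rule abs_summable_on_comparison_test)
    fix m :: nat assume "m \<in> {1..}"
    then show "norm (inverse (real m)) \<le> norm (z ^ m / of_nat m)"
      using divide_right_mono[OF one_le_power[OF z, of m], of "real m"]
      by (simp add: norm_divide norm_power inverse_eq_divide)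
  qed
  then have "(\<lambda>m. inverse (real m)) summable_on UNIV"
    by (subst (asm) summable_on_cong_neutral[where T = UNIV and g = "\<lambda>m. inverse (real m)"]) auto
  then show False
    using not_summable_harmonic[where 'a = real] summable_on_UNIV_nonneg_real_iff by force
qed

lemma primitive_word_powers_has_sum:
  assumes "cyclic_log_sum M S L"
  shows "((\<lambda>(p, m). cyclic_weight M p ^ m / of_nat m / of_nat (length p)) has_sum L)
    ({p \<in> lists S. primitive_word p} \<times> {1..})"
  using assms has_sum_reindex_bij_betw[OF bij_betw_word_pow,
      of "\<lambda>w. cyclic_weight M w / of_nat (length w)" S L]
  by (simp add: case_prod_unfold cyclic_weight_word_pow)

lemma norm_cyclic_weight_primitive_word_less_one:
  assumes sum: "cyclic_log_sum M S L" and p: "p \<in> lists S" "primitive_word p"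
  shows "cmod (cyclic_weight M p) < 1"
proof (rule norm_less_one_if_log_series_summable)
  let ?term = "\<lambda>p m. cyclic_weight M p ^ m / of_nat m / of_nat (length p)"
  have "?term p summable_on {1..}"
    using primitive_word_powers_has_sum[OF sum] p
    by (intro summable_on_SigmaD1[of ?term "{p \<in> lists S. primitive_word p}"])
      (auto simp: summable_on_def)
  then have "(\<lambda>m. ?term p m * of_nat (length p)) summable_on {1..}"
    by (rule summable_on_cmult_left)
  then show "(\<lambda>m. cyclic_weight M p ^ m / of_nat m) summable_on {1..}"
    using p(2) by (simp add: primitive_word_nonempty)
qed

lemma primitive_words_has_sum:
  assumes sum: "cyclic_log_sum M S L"
  shows "((\<lambda>p. - Ln (1 - cyclic_weight M p) / of_nat (length p)) has_sum L)
    {p \<in> lists S. primitive_word p}"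
proof (rule has_sum_SigmaD[OF primitive_word_powers_has_sum[OF sum]])
  fix p assume "p \<in> {p \<in> lists S. primitive_word p}"
  then have "cmod (cyclic_weight M p) < 1"
    using norm_cyclic_weight_primitive_word_less_one[OF sum] by blast
  then have "((\<lambda>m. cyclic_weight M p ^ m / of_nat m * (1 / of_nat (length p)))
      has_sum (- Ln (1 - cyclic_weight M p) * (1 / of_nat (length p)))) {1..}"
    by (intro has_sum_cmult_left neg_Ln_one_minus_has_sum)
  then show "((\<lambda>m. case (p, m) of (p, m) \<Rightarrow> cyclic_weight M p ^ m / of_nat m / of_nat (length p))
      has_sum (- Ln (1 - cyclic_weight M p) / of_nat (length p))) {1..}" by simp
qed

lemma primitive_necklaces_has_sum:
  assumes sum: "cyclic_log_sum M S L"
  shows "((\<lambda>c. - Ln (1 - necklace_weight M c)) has_sum L) (primitive_necklaces S)"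
proof -
  let ?g = "\<lambda>p. - Ln (1 - cyclic_weight M p) / of_nat (length p)"
  have "(?g has_sum L) {p \<in> lists S. primitive_word p}"
    by (rule primitive_words_has_sum[OF sum])
  then have "((\<lambda>(c, p). ?g p) has_sum L) (SIGMA c:primitive_necklaces S. c)"
    using has_sum_reindex_bij_betw[OF bij_betw_snd_primitive_necklaces, of ?g S L]
    by (simp add: case_prod_unfold)
  then show ?thesis
  proof (rule has_sum_SigmaD)
    fix c assume c: "c \<in> primitive_necklaces S"
    then obtain p where p: "primitive_word p" "c = rotations p"
      by (auto simp: primitive_necklaces_def)
    have "?g q = - Ln (1 - necklace_weight M c) / of_nat (length p)" if "q \<in> c" for q
    proof -
      have "length q = length p" using that p(2) by (auto simp: rotations_def)
      then show ?thesis by (simp add: necklace_weight_eq[OF c that])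
    qed
    then have "(\<Sum>q\<in>c. ?g q) = - Ln (1 - necklace_weight M c)"
      using p by (simp add: card_rotations_primitive_word primitive_word_nonempty)
    then show "((\<lambda>q. case (c, q) of (c, q) \<Rightarrow> ?g q) has_sum - Ln (1 - necklace_weight M c)) c"
      by (intro has_sum_finiteI) (auto simp: p(2) finite_rotations)
  qed
qed

lemma prod_inverse_one_minus_tendsto:
  fixes w :: "'a \<Rightarrow> complex"
  assumes sum: "((\<lambda>x. - Ln (1 - w x)) has_sum L) A" and lt: "\<And>x. x \<in> A \<Longrightarrow> cmod (w x) < 1"
  shows "((\<lambda>F. \<Prod>x\<in>F. inverse (1 - w x)) \<longlongrightarrow> exp L) (finite_subsets_at_top A)"
proof (rule Lim_transform_eventually)
  show "((\<lambda>F. exp (\<Sum>x\<in>F. - Ln (1 - w x))) \<longlongrightarrow> exp L) (finite_subsets_at_top A)"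
    using sum unfolding has_sum_def by (rule tendsto_exp)
  show "eventually (\<lambda>F. exp (\<Sum>x\<in>F. - Ln (1 - w x)) = (\<Prod>x\<in>F. inverse (1 - w x)))
      (finite_subsets_at_top A)"
  proof (rule eventually_finite_subsets_at_top_weakI)
    fix F assume "finite F" "F \<subseteq> A"
    then show "exp (\<Sum>x\<in>F. - Ln (1 - w x)) = (\<Prod>x\<in>F. inverse (1 - w x))"
      using lt by (auto simp: exp_sum exp_neg_Ln_one_minus simp del: exp_minus intro!: prod.cong)
  qed
qed

section \<open>A Bass-type determinant formula\<close>

definition nonbacktracking :: "'a \<times> 'a \<Rightarrow> 'a \<times> 'a \<Rightarrow> bool" where
  "nonbacktracking e f \<longleftrightarrow> snd e = fst f \<and> f \<noteq> prod.swap e"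

definition nonbacktracking_weight :: "('a \<times> 'a \<Rightarrow> 'b::zero) \<Rightarrow> 'a \<times> 'a \<Rightarrow> 'a \<times> 'a \<Rightarrow> 'b" where
  "nonbacktracking_weight u e f = (if nonbacktracking e f then u f else 0)"

text \<open>
  The geometric series with first term \<open>u e\<close> and ratio \<open>u e * u (prod.swap e)\<close>, over all traversals
  back and forth along \<open>e\<close>.
\<close>

definition resummed_weight :: "('a \<times> 'a \<Rightarrow> 'b::field) \<Rightarrow> 'a \<times> 'a \<Rightarrow> 'b" where
  "resummed_weight u e = u e / (1 - u e * u (prod.swap e))"

definition bass_entry :: "('a \<times> 'a) set \<Rightarrow> ('a \<times> 'a \<Rightarrow> 'b::field) \<Rightarrow> 'a \<Rightarrow> 'a \<Rightarrow> 'b" where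
  "bass_entry E u i j =
    (if i = j then 1 + (\<Sum>e | e \<in> E \<and> fst e = i. resummed_weight u e * u (prod.swap e)) else 0)
    - (if (i, j) \<in> E then resummed_weight u (i, j) else 0)"

lemma det_carrier_mat_2:
  fixes A :: "'a::comm_ring_1 mat"
  assumes "A \<in> carrier_mat 2 2"
  shows "det A = A $$ (0, 0) * A $$ (1, 1) - A $$ (0, 1) * A $$ (1, 0)"
proof -
  have det_1: "det B = B $$ (0, 0)" if "B \<in> carrier_mat 1 1" for B :: "'a mat"
    using that by (simp add: det_single)
  have "det A = (\<Sum>j<2. A $$ (0, j) * cofactor A 0 j)"
    by (rule laplace_expansion_row[OF assms]) simp
  also have "\<dots> = A $$ (0, 0) * A $$ (1, 1) - A $$ (0, 1) * A $$ (1, 0)"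
    using assms mat_delete_carrier[of A 2 2 0 0] mat_delete_carrier[of A 2 2 0 1]
    by (simp add: cofactor_def det_1 mat_delete_def numeral_2_eq_2)
  finally show ?thesis .
qed

lemma det_four_block_one_mat:
  fixes X Y :: "'a::idom mat"
  assumes X: "X \<in> carrier_mat n m" and Y: "Y \<in> carrier_mat m n"
  shows "det (four_block_mat (1\<^sub>m n) X Y (1\<^sub>m m)) = det (1\<^sub>m n - X * Y)"
    and "det (four_block_mat (1\<^sub>m n) X Y (1\<^sub>m m)) = det (1\<^sub>m m - Y * X)"
proof -
  let ?B = "four_block_mat (1\<^sub>m n) X Y (1\<^sub>m m)"
  let ?T = "four_block_mat (1\<^sub>m n) (0\<^sub>m n m) (- Y) (1\<^sub>m m)"
  have B: "?B \<in> carrier_mat (n + m) (n + m)" and T: "?T \<in> carrier_mat (n + m) (n + m)"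
    using X Y by auto
  have minus_Y: "- Y \<in> carrier_mat m n" using Y by simp
  have det_T: "det ?T = 1"
    using det_four_block_mat_upper_right_zero[OF one_carrier_mat refl minus_Y one_carrier_mat] by simp
  have "?B * ?T = four_block_mat (1\<^sub>m n * 1\<^sub>m n + X * (- Y)) (1\<^sub>m n * 0\<^sub>m n m + X * 1\<^sub>m m)
      (Y * 1\<^sub>m n + 1\<^sub>m m * (- Y)) (Y * 0\<^sub>m n m + 1\<^sub>m m * 1\<^sub>m m)"
    by (rule mult_four_block_mat[OF _ X Y _ _ _ minus_Y]) auto
  also have "\<dots> = four_block_mat (1\<^sub>m n - X * Y) X (0\<^sub>m m n) (1\<^sub>m m)"
    using X Y by (intro cong_four_block_mat) (auto intro!: eq_matI)
  also have "det \<dots> = det (1\<^sub>m n - X * Y) * det (1\<^sub>m m)"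
    by (rule det_four_block_mat_lower_left_zero) (use X Y in auto)
  finally show "det ?B = det (1\<^sub>m n - X * Y)" by (simp add: det_mult[OF B T] det_T)
  have "?T * ?B = four_block_mat (1\<^sub>m n * 1\<^sub>m n + 0\<^sub>m n m * Y) (1\<^sub>m n * X + 0\<^sub>m n m * 1\<^sub>m m)
      (- Y * 1\<^sub>m n + 1\<^sub>m m * Y) (- Y * X + 1\<^sub>m m * 1\<^sub>m m)"
    by (rule mult_four_block_mat[OF _ _ minus_Y _ _ X Y]) auto
  also have "\<dots> = four_block_mat (1\<^sub>m n) X (0\<^sub>m m n) (1\<^sub>m m - Y * X)"
    using X Y by (intro cong_four_block_mat) (auto intro!: eq_matI)
  also have "det \<dots> = det (1\<^sub>m n) * det (1\<^sub>m m - Y * X)"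
    by (rule det_four_block_mat_lower_left_zero) (use X Y in auto)
  finally show "det ?B = det (1\<^sub>m m - Y * X)" by (simp add: det_mult[OF T B] det_T)
qed

text \<open>
  The arcs of the graph are listed as \<open>us @ map prod.swap us\<close>, each edge in one chosen orientation
  followed by the opposite orientations. With \<open>K = I +\<close> weighted arc reversal, the non-backtracking
  matrix is \<open>I - K + P Y\<close>, where \<open>P Y\<close> passes through the vertices and hence has small rank. Since
  \<open>P = K X\<close>, the determinant of \<open>K - P Y = K (I - X Y)\<close> reduces to that of \<open>I - Y X\<close>.
\<close>

locale arc_list =
  fixes us :: "('a \<times> 'a) list" and vs :: "'a list" and u :: "'a \<times> 'a \<Rightarrow> 'b::field"
  assumes distinct_arcs: "distinct (us @ map prod.swap us)"
    and distinct_vertices: "distinct vs"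
    and endpoints: "fst ` set us \<union> snd ` set us \<subseteq> set vs"
    and nonresonant: "\<And>e. e \<in> set us \<Longrightarrow> u e * u (prod.swap e) \<noteq> 1"
begin

abbreviation arcs :: "('a \<times> 'a) list" where
  "arcs \<equiv> us @ map prod.swap us"

lemma arc_iff: "e \<in> set arcs \<longleftrightarrow> e \<in> set us \<or> prod.swap e \<in> set us"
  by (cases e) (auto intro: rev_image_eqI)

lemma swap_arc: "e \<in> set arcs \<Longrightarrow> prod.swap e \<in> set arcs"
  unfolding arc_iff by auto

lemma arc_endpoints: "e \<in> set arcs \<Longrightarrow> fst e \<in> set vs \<and> snd e \<in> set vs"
  using endpoints by auto

lemma swap_neq: "e \<in> set us \<Longrightarrow> f \<in> set us \<Longrightarrow> prod.swap e \<noteq> f"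
  using distinct_arcs by auto

lemma swap_arc_neq: "e \<in> set arcs \<Longrightarrow> prod.swap e \<noteq> e"
  using swap_neq[of e e] swap_neq[of "prod.swap e" "prod.swap e"] unfolding arc_iff
  by (metis swap_swap)

lemma nonresonant_arc: "e \<in> set arcs \<Longrightarrow> u e * u (prod.swap e) \<noteq> 1"
  using nonresonant[of e] nonresonant[of "prod.swap e"] unfolding arc_iff
  by (metis mult.commute swap_swap)

definition reversal :: "'a \<times> 'a \<Rightarrow> 'a \<times> 'a \<Rightarrow> 'b" where
  "reversal e f = (if f = e then 1 else 0) + (if f = prod.swap e then u f else 0)"

definition arc_head :: "'a \<times> 'a \<Rightarrow> 'a \<Rightarrow> 'b" where
  "arc_head e j = (if snd e = j then 1 else 0)"

definition weighted_arc_tail :: "'a \<Rightarrow> 'a \<times> 'a \<Rightarrow> 'b" where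
  "weighted_arc_tail i f = (if fst f = i then u f else 0)"

definition resolved_head :: "'a \<times> 'a \<Rightarrow> 'a \<Rightarrow> 'b" where
  "resolved_head e j = ((if snd e = j then 1 else 0) - (if fst e = j then u (prod.swap e) else 0))
    / (1 - u e * u (prod.swap e))"

lemma reversal_times_resolved_head:
  "indexed_mat arcs arcs reversal * indexed_mat arcs vs resolved_head = indexed_mat arcs vs arc_head"
  unfolding mult_indexed_mat[OF distinct_arcs]
proof (rule indexed_mat_cong)
  fix e j assume e: "e \<in> set arcs"
  let ?w = "1 - u e * u (prod.swap e)"
  define h where "h = (if snd e = j then 1 else (0::'b))"
  define t where "t = (if fst e = j then 1 else (0::'b))"
  have "(\<Sum>f\<in>set arcs. reversal e f * resolved_head f j)
      = (\<Sum>f\<in>set arcs. if f = e then resolved_head e j else 0)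
        + (\<Sum>f\<in>set arcs. if f = prod.swap e then u f * resolved_head f j else 0)"
    unfolding sum.distrib[symmetric]
    by (rule sum.cong) (auto simp: reversal_def distrib_right)
  also have "\<dots> = resolved_head e j + u (prod.swap e) * resolved_head (prod.swap e) j"
    using e swap_arc[OF e] by (simp add: sum.delta del: set_append)
  also have "\<dots> = (h - t * u (prod.swap e)) / ?w + u (prod.swap e) * ((t - h * u e) / ?w)"
    by (simp add: resolved_head_def h_def t_def mult.commute)
  also have "\<dots> = h * ?w / ?w" by (simp add: add_divide_distrib[symmetric] algebra_simps)
  also have "\<dots> = arc_head e j" using nonresonant_arc[OF e] by (simp add: arc_head_def h_def)
  finally show "(\<Sum>f\<in>set arcs. reversal e f * resolved_head f j) = arc_head e j" .
qed

lemma one_minus_nonbacktracking_eq: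
  "1\<^sub>m (length arcs) - indexed_mat arcs arcs (nonbacktracking_weight u)
    = indexed_mat arcs arcs reversal
      - indexed_mat arcs vs arc_head * indexed_mat vs arcs weighted_arc_tail"
  unfolding one_mat_eq_indexed_mat[OF distinct_arcs] mult_indexed_mat[OF distinct_vertices]
    minus_indexed_mat
proof (rule indexed_mat_cong)
  fix e f assume e: "e \<in> set arcs"
  have "(\<Sum>i\<in>set vs. arc_head e i * weighted_arc_tail i f)
      = (\<Sum>i\<in>set vs. if i = snd e then (if snd e = fst f then u f else 0) else 0)"
    by (rule sum.cong) (auto simp: arc_head_def weighted_arc_tail_def)
  also have "\<dots> = (if snd e = fst f then u f else 0)"
    using arc_endpoints[OF e] by (simp add: sum.delta)
  finally show "(if e = f then 1 else 0) - nonbacktracking_weight u e f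
      = reversal e f - (\<Sum>i\<in>set vs. arc_head e i * weighted_arc_tail i f)"
    using swap_arc_neq[OF e]
    by (auto simp: reversal_def nonbacktracking_weight_def nonbacktracking_def)
qed

lemma det_reversal: "det (indexed_mat arcs arcs reversal) = (\<Prod>e\<in>set us. 1 - u e * u (prod.swap e))"
proof -
  have us: "distinct us" using distinct_arcs by simp
  define D where "D = (\<lambda>w. indexed_mat us us (\<lambda>e f. if e = f then w e else (0::'b)))"
  have D: "D w \<in> carrier_mat (length us) (length us)" for w by (simp add: D_def)
  have one: "1\<^sub>m (length us) = D (\<lambda>e. 1)" unfolding D_def by (rule one_mat_eq_indexed_mat[OF us])
  have mult: "D w * D w' = D (\<lambda>e. w e * w' e)" for w w'
    unfolding D_def mult_indexed_mat[OF us]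
    by (rule indexed_mat_cong) (simp add: if_distrib[of "\<lambda>t. t * _"] sum.delta cong: if_cong)
  have entries: "reversal e f = (if e = f then 1 else 0)"
    "reversal e (prod.swap f) = (if e = f then u (prod.swap e) else 0)"
    "reversal (prod.swap e) f = (if e = f then u e else 0)"
    "reversal (prod.swap e) (prod.swap f) = (if e = f then 1 else 0)"
    if "e \<in> set us" "f \<in> set us" for e f
    using swap_neq[OF that] swap_neq[OF that(2,1)]
    by (auto simp: reversal_def inj_eq[OF inj_swap])
  have "indexed_mat arcs arcs reversal
      = four_block_mat (1\<^sub>m (length us)) (D (\<lambda>e. u (prod.swap e))) (D u) (1\<^sub>m (length us))"
    unfolding indexed_mat_append one D_def
    by (intro cong_four_block_mat eq_matI) (simp_all add: entries)
  also have "det \<dots> = det (1\<^sub>m (length us) * 1\<^sub>m (length us) - D (\<lambda>e. u (prod.swap e)) * D u)"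
    by (rule det_four_block_mat[OF _ D D])
      (simp_all add: left_mult_one_mat[OF D] right_mult_one_mat[OF D])
  also have "1\<^sub>m (length us) * 1\<^sub>m (length us) - D (\<lambda>e. u (prod.swap e)) * D u
      = D (\<lambda>e. 1 - u e * u (prod.swap e))"
    unfolding one mult unfolding D_def minus_indexed_mat by (rule indexed_mat_cong) auto
  also have "det \<dots> = (\<Prod>e\<in>set us. 1 - u e * u (prod.swap e))"
    unfolding D_def by (rule det_indexed_mat_diagonal[OF us])
  finally show ?thesis .
qed

lemma one_minus_tail_times_resolved_head:
  "1\<^sub>m (length vs) - indexed_mat vs arcs weighted_arc_tail * indexed_mat arcs vs resolved_head
    = indexed_mat vs vs (bass_entry (set arcs) u)"
  unfolding one_mat_eq_indexed_mat[OF distinct_vertices] mult_indexed_mat[OF distinct_arcs]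
    minus_indexed_mat
proof (rule indexed_mat_cong)
  fix i j
  let ?back = "\<lambda>e. resummed_weight u e * u (prod.swap e)"
  have "(\<Sum>e\<in>set arcs. weighted_arc_tail i e * resolved_head e j)
      = (\<Sum>e\<in>set arcs. if e = (i, j) then resummed_weight u e else 0)
        - (\<Sum>e\<in>set arcs. if fst e = i then (if i = j then ?back e else 0) else 0)"
    unfolding sum_subtractf[symmetric]
    by (rule sum.cong)
      (auto simp: weighted_arc_tail_def resolved_head_def resummed_weight_def diff_divide_distrib
        right_diff_distrib split: if_splits)
  also have "(\<Sum>e\<in>set arcs. if e = (i, j) then resummed_weight u e else 0)
      = (if (i, j) \<in> set arcs then resummed_weight u (i, j) else 0)"
    by (simp add: sum.delta del: set_append)
  also have "(\<Sum>e\<in>set arcs. if fst e = i then (if i = j then ?back e else 0) else 0)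
      = (if i = j then \<Sum>e | e \<in> set arcs \<and> fst e = i. ?back e else 0)"
    by (simp add: sum.inter_filter[symmetric] del: set_append)
  finally show "(if i = j then 1 else 0) - (\<Sum>e\<in>set arcs. weighted_arc_tail i e * resolved_head e j)
      = bass_entry (set arcs) u i j"
    unfolding bass_entry_def by simp
qed

theorem det_one_minus_nonbacktracking:
  "det (1\<^sub>m (length arcs) - indexed_mat arcs arcs (nonbacktracking_weight u))
    = (\<Prod>e\<in>set us. 1 - u e * u (prod.swap e)) * det (indexed_mat vs vs (bass_entry (set arcs) u))"
proof -
  let ?N = "length arcs"
  define K where "K = indexed_mat arcs arcs reversal"
  define X where "X = indexed_mat arcs vs resolved_head"
  define Y where "Y = indexed_mat vs arcs weighted_arc_tail"
  have K: "K \<in> carrier_mat ?N ?N" unfolding K_def by (rule indexed_mat_carrier)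
  have X: "X \<in> carrier_mat ?N (length vs)" unfolding X_def by (rule indexed_mat_carrier)
  have Y: "Y \<in> carrier_mat (length vs) ?N" unfolding Y_def by (rule indexed_mat_carrier)
  have XY: "X * Y \<in> carrier_mat ?N ?N" using X Y by (rule mult_carrier_mat)
  have "1\<^sub>m ?N - indexed_mat arcs arcs (nonbacktracking_weight u) = K - K * X * Y"
    unfolding one_minus_nonbacktracking_eq K_def X_def Y_def reversal_times_resolved_head ..
  also have "\<dots> = K * 1\<^sub>m ?N - K * (X * Y)"
    unfolding assoc_mult_mat[OF K X Y] right_mult_one_mat[OF K] ..
  also have "\<dots> = K * (1\<^sub>m ?N - X * Y)"
    by (rule mult_minus_distrib_mat[OF K one_carrier_mat XY, symmetric])
  also have "det \<dots> = det K * det (1\<^sub>m ?N - X * Y)"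
    by (rule det_mult[OF K minus_carrier_mat[OF XY]])
  also have "det (1\<^sub>m ?N - X * Y) = det (1\<^sub>m (length vs) - Y * X)"
    by (simp only: det_four_block_one_mat[OF X Y, symmetric])
  finally show ?thesis
    unfolding X_def Y_def K_def one_minus_tail_times_resolved_head det_reversal .
qed

end

section \<open>Orbits as necklaces of directed edges\<close>

abbreviation chained :: "('a \<times> 'a) list \<Rightarrow> bool" where
  "chained \<equiv> cyclically (\<lambda>e f. snd e = fst f)"

definition walk_of :: "('a \<times> 'a) list \<Rightarrow> 'a list" where
  "walk_of es = fst (hd es) # map snd es"

lemma chained_iff: "chained es \<longleftrightarrow> map snd es = rotate1 (map fst es)"
  by (simp add: cyclically_iff_list_all2 rotate1_map list_eq_iff_nth_eq list_all2_conv_all_nth)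

lemma chained_cyclic_pairs: "chained (cyclic_pairs w)"
  by (simp add: chained_iff cyclic_pairs_def)

lemma walk_of_cyclic_pairs: "w \<noteq> [] \<Longrightarrow> walk_of (cyclic_pairs w) = w @ [hd w]"
  by (cases w; cases "tl w") (simp_all add: walk_of_def cyclic_pairs_def)

lemma steps_closed:
  assumes "w \<noteq> []"
  shows "steps (w @ [hd w]) = cyclic_pairs w"
proof -
  have "steps (w @ [hd w]) = zip (w @ [hd w]) (rotate1 w @ [])"
    using assms by (simp add: steps_def rotate1_hd_tl)
  also have "\<dots> = cyclic_pairs w"
    unfolding cyclic_pairs_def by (subst zip_append) auto
  finally show ?thesis .
qed

lemma chained_eq_cyclic_pairs: "chained es \<Longrightarrow> es = cyclic_pairs (map fst es)"
  by (metis chained_iff cyclic_pairs_def zip_map_fst_snd)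

lemma is_walk_iff_steps:
  assumes "length ws \<ge> 2"
  shows "is_walk R ws \<longleftrightarrow> set (steps ws) \<subseteq> dir_edges R"
proof -
  have step: "is_walk R (v # w # ws) \<longleftrightarrow> (v, w) \<in> dir_edges R \<and> is_walk R (w # ws)" for v w ws
    by (auto simp: is_walk_def dir_edges_def All_less_Suc2)
  have "is_walk R (v # w # ws) \<longleftrightarrow> set (steps (v # w # ws)) \<subseteq> dir_edges R" for v w ws
  proof (induction ws arbitrary: v w)
    case Nil
    show ?case unfolding step by (auto simp: is_walk_def dir_edges_def steps_def)
  next
    case (Cons x ws)
    show ?case unfolding step[of v w] Cons by (simp add: steps_def)
  qed
  moreover obtain v w ws' where "ws = v # w # ws'"
    using assms by (cases ws; cases "tl ws") auto
  ultimately show ?thesis by simp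
qed

lemma is_closed_walk_iff:
  "is_closed_walk R ws \<longleftrightarrow> (\<exists>w. w \<noteq> [] \<and> ws = w @ [hd w] \<and> set (cyclic_pairs w) \<subseteq> dir_edges R)"
proof
  assume closed: "is_closed_walk R ws"
  define w where "w = butlast ws"
  have len: "length ws \<ge> 2" using closed by (simp add: is_closed_walk_def)
  then have w: "w \<noteq> []" "hd w = hd ws" "ws = w @ [last ws]"
    unfolding w_def by (cases ws; cases "tl ws"; auto)+
  then have ws: "ws = w @ [hd w]" using closed by (simp add: is_closed_walk_def)
  have "set (steps ws) \<subseteq> dir_edges R"
    using closed is_walk_iff_steps[OF len] by (simp add: is_closed_walk_def)
  then have "set (cyclic_pairs w) \<subseteq> dir_edges R" by (simp only: ws steps_closed[OF w(1)])
  then show "\<exists>w. w \<noteq> [] \<and> ws = w @ [hd w] \<and> set (cyclic_pairs w) \<subseteq> dir_edges R"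
    using w(1) ws by blast
next
  assume "\<exists>w. w \<noteq> [] \<and> ws = w @ [hd w] \<and> set (cyclic_pairs w) \<subseteq> dir_edges R"
  then obtain w where w: "w \<noteq> []" "ws = w @ [hd w]" "set (cyclic_pairs w) \<subseteq> dir_edges R" by blast
  then have len: "length ws \<ge> 2" by (simp add: Suc_le_eq)
  have "is_walk R ws" unfolding is_walk_iff_steps[OF len] using w by (simp add: steps_closed)
  then show "is_closed_walk R ws" using len w by (simp add: is_closed_walk_def)
qed

definition closed_step_lists :: "real mat \<Rightarrow> (nat \<times> nat) list set" where
  "closed_step_lists R = {es \<in> lists (dir_edges R). es \<noteq> [] \<and> chained es}"

lemma steps_in_closed_step_lists: "is_closed_walk R ws \<Longrightarrow> steps ws \<in> closed_step_lists R"
  by (auto simp: is_closed_walk_iff closed_step_lists_def steps_closed chained_cyclic_pairs)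
    (simp add: cyclic_pairs_def)

lemma walk_of_steps: "is_closed_walk R ws \<Longrightarrow> walk_of (steps ws) = ws"
  by (auto simp: is_closed_walk_iff steps_closed walk_of_cyclic_pairs)

lemma steps_walk_of:
  assumes "es \<in> closed_step_lists R"
  shows "steps (walk_of es) = es" "is_closed_walk R (walk_of es)"
proof -
  define w where "w = map fst es"
  have w: "w \<noteq> []" "es = cyclic_pairs w" "set es \<subseteq> dir_edges R"
    using assms chained_eq_cyclic_pairs by (auto simp: w_def closed_step_lists_def)
  then show "steps (walk_of es) = es" by (simp add: walk_of_cyclic_pairs steps_closed)
  show "is_closed_walk R (walk_of es)"
    using w by (auto simp: is_closed_walk_iff walk_of_cyclic_pairs)
qed

lemma closed_step_lists_word_pow:
  "m > 0 \<Longrightarrow> word_pow es m \<in> closed_step_lists R \<longleftrightarrow> es \<in> closed_step_lists R"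
  by (auto simp: closed_step_lists_def lists_eq_set set_word_pow cyclically_word_pow)

lemma closed_step_lists_rotate: "rotate k es \<in> closed_step_lists R \<longleftrightarrow> es \<in> closed_step_lists R"
  by (simp add: closed_step_lists_def lists_eq_set cyclically_rotate)

lemma walk_pow_walk_of:
  "es \<noteq> [] \<Longrightarrow> m > 0 \<Longrightarrow> walk_pow (walk_of es) m = walk_of (word_pow es m)"
  by (simp add: walk_pow_def walk_of_def hd_word_pow map_word_pow flip: word_pow_eq_concat_replicate)

lemma is_primitive_iff:
  "is_primitive R ws \<longleftrightarrow> is_closed_walk R ws \<and> primitive_word (steps ws)"
proof (cases "is_closed_walk R ws")
  case closed: True
  note steps_ws = steps_in_closed_step_lists[OF closed]
  have "(\<exists>c m. m \<ge> 2 \<and> is_closed_walk R c \<and> length c < length ws \<and> ws = walk_pow c m)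
      \<longleftrightarrow> (\<exists>es m. steps ws = word_pow es m \<and> m \<noteq> 1)"
  proof (intro iffI; elim exE conjE)
    fix c m assume c: "m \<ge> (2::nat)" "is_closed_walk R c" "ws = walk_pow c m"
    have c_steps: "steps c \<in> closed_step_lists R" by (rule steps_in_closed_step_lists[OF c(2)])
    then have "ws = walk_of (word_pow (steps c) m)"
      using c walk_pow_walk_of[of "steps c" m] walk_of_steps[OF c(2)]
      by (simp add: closed_step_lists_def)
    then have "steps ws = word_pow (steps c) m"
      using c(1) c_steps by (simp add: steps_walk_of(1)[of _ R] closed_step_lists_word_pow)
    then show "\<exists>es m. steps ws = word_pow es m \<and> m \<noteq> 1" using c(1) by force
  next
    fix es m assume pow: "steps ws = word_pow es m" and "m \<noteq> 1"
    have "es \<noteq> []" "m \<noteq> 0" using steps_ws by (auto simp: closed_step_lists_def pow)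
    then have m: "m \<ge> 2" using \<open>m \<noteq> 1\<close> by simp
    have ws: "ws = walk_of (word_pow es m)" using walk_of_steps[OF closed] pow by simp
    have es: "es \<in> closed_step_lists R" using steps_ws m by (simp add: pow closed_step_lists_word_pow)
    have "length es < m * length es" using m \<open>es \<noteq> []\<close> by simp
    then have "length (walk_of es) < length ws" by (simp add: ws walk_of_def)
    moreover have "ws = walk_pow (walk_of es) m"
      using \<open>es \<noteq> []\<close> m by (simp add: ws walk_pow_walk_of)
    ultimately show "\<exists>c m. m \<ge> 2 \<and> is_closed_walk R c \<and> length c < length ws \<and> ws = walk_pow c m"
      using m steps_walk_of(2)[OF es] by blast
  qed
  then show ?thesis
    using closed steps_ws by (auto simp: is_primitive_def primitive_word_def closed_step_lists_def)
qed (simp add: is_primitive_def)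

lemma bij_betw_steps_primitive:
  "bij_betw steps {ws. is_primitive R ws} {p \<in> closed_step_lists R. primitive_word p}"
  by (rule bij_betw_byWitness[where f' = walk_of])
    (auto simp: is_primitive_iff walk_of_steps steps_walk_of steps_in_closed_step_lists)

lemma steps_image_orbit:
  assumes "is_primitive R ws"
  shows "steps ` {ws'. is_primitive R ws' \<and> cyc_equiv ws ws'} = rotations (steps ws)"
proof (intro equalityI subsetI)
  fix q assume "q \<in> rotations (steps ws)"
  then obtain k where q: "q = rotate k (steps ws)" by (auto simp: rotations_def)
  have "q \<in> closed_step_lists R" "primitive_word q"
    using assms unfolding q is_primitive_iff
    by (simp_all add: steps_in_closed_step_lists closed_step_lists_rotate primitive_word_rotate)
  then have "is_primitive R (walk_of q)" "steps (walk_of q) = q"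
    by (simp_all add: is_primitive_iff steps_walk_of)
  then show "q \<in> steps ` {ws'. is_primitive R ws' \<and> cyc_equiv ws ws'}"
    using q by (intro rev_image_eqI[of "walk_of q"]) (auto simp: cyc_equiv_def)
qed (auto simp: cyc_equiv_def rotations_def)

lemma bij_betw_steps_orbits:
  "bij_betw ((`) steps) (orbits R) (rotations ` {p \<in> closed_step_lists R. primitive_word p})"
  unfolding bij_betw_def
proof (intro conjI)
  have "\<Union> (orbits R) \<subseteq> {ws. is_primitive R ws}" by (auto simp: orbits_def)
  then have "inj_on steps (\<Union> (orbits R))"
    by (rule inj_on_subset[OF bij_betw_imp_inj_on[OF bij_betw_steps_primitive]])
  then show "inj_on ((`) steps) (orbits R)" by (rule inj_on_image)
  have "orbits R = (\<lambda>ws. {ws'. is_primitive R ws' \<and> cyc_equiv ws ws'}) ` {ws. is_primitive R ws}"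
    by (auto simp: orbits_def)
  then have "(`) steps ` orbits R = (\<lambda>ws. rotations (steps ws)) ` {ws. is_primitive R ws}"
    by (simp only: image_image) (rule image_cong, simp_all only: mem_Collect_eq steps_image_orbit)
  also have "\<dots> = rotations ` steps ` {ws. is_primitive R ws}" by (simp only: image_image)
  finally show "(`) steps ` orbits R = rotations ` {p \<in> closed_step_lists R. primitive_word p}"
    by (simp only: bij_betw_imp_surj_on[OF bij_betw_steps_primitive])
qed

lemma steps_orbitD:
  assumes "\<gamma> \<in> orbits R" "p \<in> steps ` \<gamma>"
  shows "steps ` \<gamma> = rotations p" "primitive_word p" "p \<in> closed_step_lists R"
proof -
  obtain q where q: "q \<in> closed_step_lists R" "primitive_word q" "steps ` \<gamma> = rotations q"
    using bij_betw_apply[OF bij_betw_steps_orbits assms(1)] by auto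
  then obtain k where k: "p = rotate k q" using assms(2) by (auto simp: rotations_def)
  show "steps ` \<gamma> = rotations p" using rotations_eq_if_mem assms(2) q(3) by blast
  show "primitive_word p" "p \<in> closed_step_lists R"
    using q unfolding k by (simp_all add: primitive_word_rotate closed_step_lists_rotate)
qed

lemma orbit_steps_mem:
  assumes "\<gamma> \<in> orbits R"
  shows "orbit_steps \<gamma> \<in> steps ` \<gamma>"
proof -
  have "steps ` \<gamma> \<noteq> {}"
    using bij_betw_apply[OF bij_betw_steps_orbits assms] self_in_rotations by force
  then show ?thesis unfolding orbit_steps_def by (auto intro: someI)
qed

lemma backtrackless_iff:
  "backtrackless \<gamma> \<longleftrightarrow> cyclically (\<lambda>e f. f \<noteq> prod.swap e) (orbit_steps \<gamma>)"
  by (simp add: backtrackless_def Let_def cyclically_iff_list_all2 list_all2_conv_all_nth nth_rotate1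
      prod.swap_def)

lemma prod_power_count_list:
  fixes u :: "'a \<Rightarrow> 'b::comm_monoid_mult"
  assumes "finite A" "set xs \<subseteq> A"
  shows "(\<Prod>a\<in>A. u a ^ count_list xs a) = prod_list (map u xs)"
proof -
  have "(\<Prod>a\<in>A. u a ^ count_list xs a) = (\<Prod>a\<in>set xs. u a ^ count_list xs a)"
    using assms by (intro prod.mono_neutral_right) (auto simp: count_list_0_iff)
  also have "\<dots> = prod_mset (image_mset u (mset xs))"
    by (simp add: image_prod_mset_multiplicity count_mset)
  also have "\<dots> = prod_list (map u xs)" by (simp flip: prod_mset_prod_list)
  finally show ?thesis .
qed

lemma finite_dir_edges: "finite (dir_edges R)"
  by (rule finite_subset[of _ "{..<dim_row R} \<times> {..<dim_row R}"]) (auto simp: dir_edges_def)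

lemma orbit_weight_eq:
  assumes "\<gamma> \<in> orbits R"
  shows "orbit_weight R \<gamma> = prod_list (map (case_prod (r_prime R)) (orbit_steps \<gamma>))"
proof -
  have "set (orbit_steps \<gamma>) \<subseteq> dir_edges R"
    using steps_orbitD(3)[OF assms orbit_steps_mem[OF assms]] by (auto simp: closed_step_lists_def)
  then show ?thesis
    unfolding orbit_weight_def n_step_def
    by (subst prod_power_count_list[OF finite_dir_edges, symmetric]) (auto intro!: prod.cong)
qed

lemma cyclic_weight_nonbacktracking:
  fixes u :: "'a \<times> 'a \<Rightarrow> 'b::idom"
  shows "cyclic_weight (nonbacktracking_weight u) es
    = (if cyclically nonbacktracking es then prod_list (map u es) else 0)"
proof (cases "cyclically nonbacktracking es")
  case True
  then have "cyclic_weight (nonbacktracking_weight u) es = (\<Prod>p\<leftarrow>cyclic_pairs es. u (snd p))"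
    unfolding cyclic_weight_def
    by (intro arg_cong[of _ _ prod_list] map_cong refl)
      (auto simp: cyclically_def nonbacktracking_weight_def)
  also have "\<dots> = prod_list (map u (map snd (cyclic_pairs es)))" by (simp only: map_map comp_def)
  also have "\<dots> = prod_list (rotate 1 (map u es))" by (simp add: cyclic_pairs_def rotate1_map)
  also have "\<dots> = prod_list (map u es)" by (rule prod_list_rotate)
  finally show ?thesis using True by simp
next
  case False
  then obtain e f where "(e, f) \<in> set (cyclic_pairs es)" "\<not> nonbacktracking e f"
    by (auto simp: cyclically_def)
  then have "0 \<in> set (map (\<lambda>(e, f). nonbacktracking_weight u e f) (cyclic_pairs es))"
    by (force simp: nonbacktracking_weight_def intro: rev_image_eqI)
  then show ?thesis using False by (simp only: cyclic_weight_def prod_list_zero_iff if_False)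
qed

lemma cyclically_nonbacktracking_iff:
  "cyclically nonbacktracking es \<longleftrightarrow> chained es \<and> cyclically (\<lambda>e f. f \<noteq> prod.swap e) es"
  by (auto simp: cyclically_def nonbacktracking_def)

lemma necklace_weight_steps_orbit:
  fixes u :: "nat \<times> nat \<Rightarrow> 'b::idom"
  assumes \<gamma>: "\<gamma> \<in> orbits R"
  shows "necklace_weight (nonbacktracking_weight u) (steps ` \<gamma>)
    = (if backtrackless \<gamma> then prod_list (map u (orbit_steps \<gamma>)) else 0)"
proof -
  let ?p = "orbit_steps \<gamma>"
  have p: "?p \<in> steps ` \<gamma>" by (rule orbit_steps_mem[OF \<gamma>])
  note p_props = steps_orbitD[OF \<gamma> p]
  have "steps ` \<gamma> \<in> primitive_necklaces (dir_edges R)"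
    using p_props by (auto simp: primitive_necklaces_def closed_step_lists_def)
  then have "necklace_weight (nonbacktracking_weight u) (steps ` \<gamma>)
      = cyclic_weight (nonbacktracking_weight u) ?p"
    using p by (rule necklace_weight_eq)
  then show ?thesis
    using p_props(3)
    by (simp add: cyclic_weight_nonbacktracking cyclically_nonbacktracking_iff backtrackless_iff
        closed_step_lists_def)
qed

lemma necklace_weight_eq_0_if_not_orbit:
  fixes u :: "nat \<times> nat \<Rightarrow> 'b::idom"
  assumes c: "c \<in> primitive_necklaces (dir_edges R)"
    and not_orbit: "c \<notin> rotations ` {p \<in> closed_step_lists R. primitive_word p}"
  shows "necklace_weight (nonbacktracking_weight u) c = 0"
proof -
  obtain p where p: "p \<in> lists (dir_edges R)" "primitive_word p" "c = rotations p"
    using c by (auto simp: primitive_necklaces_def)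
  have "\<not> chained p"
  proof
    assume "chained p"
    then have "p \<in> {p \<in> closed_step_lists R. primitive_word p}"
      using p by (simp add: closed_step_lists_def primitive_word_nonempty)
    then show False using not_orbit p(3) by blast
  qed
  then show ?thesis
    using necklace_weight_eq[OF c, of p "nonbacktracking_weight u"] p(3) self_in_rotations[of p]
    by (simp add: cyclic_weight_nonbacktracking cyclically_nonbacktracking_iff)
qed

lemma backtrackless_orbits_has_sum:
  assumes "cyclic_log_sum (nonbacktracking_weight u) (dir_edges R) L"
  shows "((\<lambda>\<gamma>. - Ln (1 - prod_list (map u (orbit_steps \<gamma>)))) has_sum L) (backtrackless_orbits R)"
proof -
  let ?C = "rotations ` {p \<in> closed_step_lists R. primitive_word p}"
  let ?f = "\<lambda>c. - Ln (1 - necklace_weight (nonbacktracking_weight u) c)"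
  have "?C \<subseteq> primitive_necklaces (dir_edges R)"
    by (auto simp: primitive_necklaces_def closed_step_lists_def)
  then have "(?f has_sum L) ?C"
    using primitive_necklaces_has_sum[OF assms]
    by (subst has_sum_cong_neutral[where T = "primitive_necklaces (dir_edges R)" and g = ?f])
      (auto simp: necklace_weight_eq_0_if_not_orbit)
  then have "((\<lambda>\<gamma>. ?f (steps ` \<gamma>)) has_sum L) (orbits R)"
    by (simp only: has_sum_reindex_bij_betw[OF bij_betw_steps_orbits, of ?f])
  then show ?thesis
    by (subst has_sum_cong_neutral[where T = "orbits R" and g = "\<lambda>\<gamma>. ?f (steps ` \<gamma>)"])
      (auto simp: backtrackless_orbits_def necklace_weight_steps_orbit)
qed

lemma norm_prod_list_orbit_steps_less_one:
  assumes "cyclic_log_sum (nonbacktracking_weight u) (dir_edges R) L"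
    and \<gamma>: "\<gamma> \<in> backtrackless_orbits R"
  shows "cmod (prod_list (map u (orbit_steps \<gamma>))) < 1"
proof -
  let ?p = "orbit_steps \<gamma>"
  have orbit: "\<gamma> \<in> orbits R" and bt: "backtrackless \<gamma>"
    using \<gamma> by (auto simp: backtrackless_orbits_def)
  have p: "primitive_word ?p" "?p \<in> closed_step_lists R"
    using steps_orbitD[OF orbit orbit_steps_mem[OF orbit]] by auto
  then have "cmod (cyclic_weight (nonbacktracking_weight u) ?p) < 1"
    by (intro norm_cyclic_weight_primitive_word_less_one[OF assms(1)])
      (simp_all add: closed_step_lists_def)
  then show ?thesis
    using p bt by (simp add: cyclic_weight_nonbacktracking cyclically_nonbacktracking_iff
        backtrackless_iff closed_step_lists_def)
qed

section \<open>Convergence of the messages\<close>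

lemma positive_superharmonic_vector_exists:
  fixes B :: "real mat"
  assumes B: "B \<in> carrier_mat n n" and nonneg: "\<And>i j. i < n \<Longrightarrow> j < n \<Longrightarrow> B $$ (i, j) \<ge> 0"
    and spec: "spectrum (map_mat complex_of_real B) \<subseteq> ball 0 1"
  obtains x where "\<And>i. i < n \<Longrightarrow> x i > 0" and "\<And>i. i < n \<Longrightarrow> (\<Sum>k<n. B $$ (i, k) * x k) < x i"
proof -
  define g where "g = (\<lambda>i k. \<Sum>j<n. (B ^\<^sub>m k) $$ (i, j))"
  have summable: "summable (g i)" if i: "i < n" for i
    unfolding g_def
  proof (rule summable_sum)
    fix j assume "j \<in> {..<n}"
    then have "summable (\<lambda>k. cmod ((map_mat complex_of_real B ^\<^sub>m k) $$ (i, j)))"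
      using i B by (intro summable_norm_pow_mat[OF _ spec]) auto
    then have "summable (\<lambda>k. norm ((B ^\<^sub>m k) $$ (i, j)))"
      using i \<open>j \<in> {..<n}\<close> B by (simp add: of_real_hom.mat_hom_pow[OF B, symmetric])
    then show "summable (\<lambda>k. (B ^\<^sub>m k) $$ (i, j))" by (rule summable_norm_cancel)
  qed
  have g_0: "g i 0 = 1" if "i < n" for i using that B by (simp add: g_def sum.delta)
  have g_Suc: "g i (Suc k) = (\<Sum>l<n. B $$ (i, l) * g l k)" if "i < n" for i k
    unfolding g_def by (rule row_sum_pow_mat_Suc[OF B that])
  have g_nonneg: "g i k \<ge> 0" if "i < n" for i k
    using that
    by (induction k arbitrary: i) (auto simp: g_0 g_Suc nonneg intro!: sum_nonneg mult_nonneg_nonneg)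
  define x where "x = (\<lambda>i. \<Sum>k. g i k)"
  have "x i > 0" if i: "i < n" for i
    unfolding x_def by (rule suminf_pos2[OF summable[OF i], of 0]) (use g_nonneg g_0 i in auto)
  moreover have "(\<Sum>l<n. B $$ (i, l) * x l) < x i" if i: "i < n" for i
  proof -
    have "(\<lambda>k. g i (Suc k)) sums (\<Sum>l<n. B $$ (i, l) * x l)"
      unfolding g_Suc[OF i] x_def using summable by (intro sums_sum sums_mult summable_sums) auto
    then have "g i sums ((\<Sum>l<n. B $$ (i, l) * x l) + 1)" by (simp add: sums_Suc_iff g_0[OF i])
    then have "x i = (\<Sum>l<n. B $$ (i, l) * x l) + 1" unfolding x_def by (rule sums_unique[symmetric])
    then show ?thesis by simp
  qed
  ultimately show ?thesis by (rule that)
qed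

locale scaled_diagonally_dominant =
  fixes R :: "real mat" and n :: nat and x :: "nat \<Rightarrow> real"
  assumes carrier: "R \<in> carrier_mat n n"
    and sym: "\<And>i j. i < n \<Longrightarrow> j < n \<Longrightarrow> R $$ (i, j) = R $$ (j, i)"
    and zero_diag: "\<And>i. i < n \<Longrightarrow> R $$ (i, i) = 0"
    and x_pos: "\<And>i. i < n \<Longrightarrow> x i > 0"
    and dominance: "\<And>i. i < n \<Longrightarrow> (\<Sum>k<n. \<bar>R $$ (i, k)\<bar> * x k) < x i"
begin

lemma dim_R [simp]: "dim_row R = n" "dim_col R = n"
  using carrier by auto

lemma nbrs_eq: "nbrs R i = {k. k < n \<and> R $$ (i, k) \<noteq> 0}"
  by (simp add: nbrs_def)

lemma finite_nbrs [simp]: "finite (nbrs R i)"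
  by (simp add: nbrs_eq)

lemma dir_edges_swap: "(i, j) \<in> dir_edges R \<Longrightarrow> (j, i) \<in> dir_edges R"
  using sym by (auto simp: dir_edges_def)

lemma neighbour_sum_less:
  assumes i: "i < n" and j: "j < n"
  shows "\<bar>R $$ (i, j)\<bar> * x j + (\<Sum>k\<in>nbrs R i - {j}. \<bar>R $$ (i, k)\<bar> * x k) < x i"
proof -
  have "(\<Sum>k\<in>nbrs R i - {j}. \<bar>R $$ (i, k)\<bar> * x k) = (\<Sum>k\<in>{..<n} - {j}. \<bar>R $$ (i, k)\<bar> * x k)"
    by (rule sum.mono_neutral_left) (auto simp: nbrs_eq)
  then show ?thesis
    using dominance[OF i] j by (simp add: sum.remove[of "{..<n}" j])
qed

lemma cavity_denominator_gt:
  assumes i: "i < n" and j: "j < n" and a: "\<And>k. k < n \<Longrightarrow> a k \<le> \<bar>R $$ (k, i)\<bar> * x k / x i"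
  shows "\<bar>R $$ (i, j)\<bar> * x j < x i * (1 - (\<Sum>k\<in>nbrs R i - {j}. a k))"
proof -
  have "x i * (\<Sum>k\<in>nbrs R i - {j}. a k) \<le> (\<Sum>k\<in>nbrs R i - {j}. \<bar>R $$ (i, k)\<bar> * x k)"
    unfolding sum_distrib_left
  proof (rule sum_mono)
    fix k assume "k \<in> nbrs R i - {j}"
    then have "k < n" by (simp add: nbrs_eq)
    then show "x i * a k \<le> \<bar>R $$ (i, k)\<bar> * x k"
      using a[of k] x_pos[OF i] sym[of k i] i by (simp add: field_simps)
  qed
  then show ?thesis using neighbour_sum_less[OF i j] by (simp add: right_diff_distrib)
qed

lemma denominator_pos:
  assumes "i < n" "j < n" "\<bar>R $$ (i, j)\<bar> * x j < x i * d"
  shows "d > 0"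
proof -
  have "0 \<le> \<bar>R $$ (i, j)\<bar> * x j" using x_pos[OF assms(2)] by simp
  then have "0 < x i * d" using assms(3) by linarith
  then show ?thesis using x_pos[OF assms(1)] by (simp add: zero_less_mult_iff)
qed

lemma message_le:
  assumes i: "i < n" and j: "j < n" and d: "\<bar>R $$ (i, j)\<bar> * x j < x i * d"
  shows "(R $$ (i, j))\<^sup>2 * inverse d \<le> \<bar>R $$ (i, j)\<bar> * x i / x j"
proof -
  let ?r = "\<bar>R $$ (i, j)\<bar>"
  have "?r * (?r * x j) \<le> ?r * (x i * d)" using d by (intro mult_left_mono) auto
  then have "?r\<^sup>2 * x j \<le> ?r * x i * d" by (simp add: power2_eq_square mult_ac)
  then show ?thesis using x_pos[OF j] denominator_pos[OF i j d] by (simp add: field_simps)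
qed

lemma alpha_iter_bounds:
  assumes "i < n" "j < n"
  shows "0 \<le> alpha_iter R t i j \<and> alpha_iter R t i j \<le> \<bar>R $$ (i, j)\<bar> * x i / x j"
  using assms
proof (induction t arbitrary: i j)
  case 0
  then show ?case using x_pos[of i] x_pos[of j] by simp
next
  case (Suc t)
  have d: "\<bar>R $$ (i, j)\<bar> * x j < x i * (1 - (\<Sum>k\<in>nbrs R i - {j}. alpha_iter R t k i))"
    by (rule cavity_denominator_gt) (use Suc in auto)
  then show ?case
    using message_le[OF Suc.prems d] denominator_pos[OF Suc.prems d] by simp
qed

lemma alpha_iter_denominator_pos:
  assumes "i < n" "j < n"
  shows "1 - (\<Sum>k\<in>nbrs R i - {j}. alpha_iter R t k i) > 0"
  by (rule denominator_pos[OF assms cavity_denominator_gt]) (use assms alpha_iter_bounds in auto)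

lemma alpha_iter_mono:
  assumes "i < n" "j < n"
  shows "alpha_iter R t i j \<le> alpha_iter R (Suc t) i j"
  using assms
proof (induction t arbitrary: i j)
  case 0
  then show ?case using alpha_iter_bounds[of i j "Suc 0"] by simp
next
  case (Suc t)
  let ?d = "\<lambda>t. 1 - (\<Sum>k\<in>nbrs R i - {j}. alpha_iter R t k i)"
  have "?d (Suc t) \<le> ?d t"
    using Suc by (intro diff_left_mono sum_mono) (auto simp: nbrs_eq simp del: alpha_iter.simps)
  then have "inverse (?d t) \<le> inverse (?d (Suc t))"
    using alpha_iter_denominator_pos[OF Suc.prems] by (rule le_imp_inverse_le)
  then have "(R $$ (i, j))\<^sup>2 * inverse (?d t) \<le> (R $$ (i, j))\<^sup>2 * inverse (?d (Suc t))"
    by (rule mult_left_mono) simp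
  then show ?case by (simp only: alpha_iter.simps(2))
qed

lemma alpha_iter_tendsto:
  assumes "i < n" "j < n"
  shows "(\<lambda>t. alpha_iter R t i j) \<longlonglongrightarrow> alpha R i j"
proof -
  have "incseq (\<lambda>t. alpha_iter R t i j)"
    using alpha_iter_mono[OF assms] by (rule incseq_SucI)
  moreover have "alpha_iter R t i j \<le> \<bar>R $$ (i, j)\<bar> * x i / x j" for t
    using alpha_iter_bounds[OF assms] by blast
  ultimately obtain l where "(\<lambda>t. alpha_iter R t i j) \<longlonglongrightarrow> l"
    using incseq_convergent by blast
  then show ?thesis unfolding alpha_def by (simp add: limI)
qed

lemma alpha_bounds:
  assumes "i < n" "j < n"
  shows "0 \<le> alpha R i j" "alpha R i j \<le> \<bar>R $$ (i, j)\<bar> * x i / x j"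
  using LIMSEQ_le_const[OF alpha_iter_tendsto[OF assms], of 0]
    LIMSEQ_le_const2[OF alpha_iter_tendsto[OF assms], of "\<bar>R $$ (i, j)\<bar> * x i / x j"]
    alpha_iter_bounds[OF assms] by auto

lemma one_minus_alpha_excl_gt:
  assumes "i < n" "j < n"
  shows "\<bar>R $$ (i, j)\<bar> * x j < x i * (1 - alpha_excl R i j)"
  unfolding alpha_excl_def by (rule cavity_denominator_gt) (use assms alpha_bounds in auto)

lemma one_minus_alpha_excl_pos: "i < n \<Longrightarrow> j < n \<Longrightarrow> 1 - alpha_excl R i j > 0"
  using denominator_pos one_minus_alpha_excl_gt by blast

lemma one_minus_sum_alpha_pos:
  assumes "i < n"
  shows "1 - (\<Sum>k\<in>nbrs R i. alpha R k i) > 0"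
proof -
  have "nbrs R i - {i} = nbrs R i" using zero_diag[OF assms] by (auto simp: nbrs_eq)
  then show ?thesis using one_minus_alpha_excl_pos[OF assms assms] by (simp add: alpha_excl_def)
qed

section \<open>The belief-propagation estimate as a determinant\<close>

lemma alpha_eq:
  assumes "i < n" "j < n"
  shows "alpha R i j = R $$ (i, j) * r_prime R i j"
proof (rule LIMSEQ_unique)
  show "(\<lambda>t. alpha_iter R (Suc t) i j) \<longlonglongrightarrow> alpha R i j"
    by (rule LIMSEQ_Suc[OF alpha_iter_tendsto[OF assms]])
  have "(\<lambda>t. (R $$ (i, j))\<^sup>2 * inverse (1 - (\<Sum>k\<in>nbrs R i - {j}. alpha_iter R t k i)))
      \<longlonglongrightarrow> (R $$ (i, j))\<^sup>2 * inverse (1 - alpha_excl R i j)"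
    unfolding alpha_excl_def
    using one_minus_alpha_excl_pos[OF assms] assms
    by (intro tendsto_intros alpha_iter_tendsto) (auto simp: nbrs_eq alpha_excl_def)
  then show "(\<lambda>t. alpha_iter R (Suc t) i j) \<longlonglongrightarrow> R $$ (i, j) * r_prime R i j"
    by (simp add: r_prime_def power2_eq_square divide_inverse mult_ac)
qed

lemma one_minus_sum_alpha_eq:
  assumes "(i, j) \<in> dir_edges R"
  shows "1 - (\<Sum>k\<in>nbrs R i. alpha R k i) = (1 - alpha_excl R i j) * (1 - r_prime R i j * r_prime R j i)"
proof -
  have ij: "i < n" "j < n" "j \<in> nbrs R i" using assms by (auto simp: dir_edges_def nbrs_eq)
  have "(1 - alpha_excl R i j) * r_prime R i j = R $$ (i, j)"
    using one_minus_alpha_excl_pos[OF ij(1,2)] by (simp add: r_prime_def)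
  then have "(1 - alpha_excl R i j) * (r_prime R i j * r_prime R j i) = alpha R j i"
    using alpha_eq[OF ij(2,1)] sym[OF ij(1,2)] by (simp add: mult.assoc[symmetric])
  moreover have "(\<Sum>k\<in>nbrs R i. alpha R k i) = alpha_excl R i j + alpha R j i"
    unfolding alpha_excl_def using ij(3) by (simp add: sum.remove[of "nbrs R i" j])
  ultimately show ?thesis by (simp add: right_diff_distrib)
qed

lemma one_minus_r_prime_mult_pos:
  assumes "(i, j) \<in> dir_edges R"
  shows "1 - r_prime R i j * r_prime R j i > 0"
proof -
  have ij: "i < n" "j < n" using assms by (auto simp: dir_edges_def)
  show ?thesis using one_minus_sum_alpha_eq[OF assms] one_minus_sum_alpha_pos[OF ij(1)]
      one_minus_alpha_excl_pos[OF ij] by (metis zero_less_mult_pos)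
qed

lemma Z_node_pos: "i < n \<Longrightarrow> Z_node R i > 0"
  using one_minus_sum_alpha_pos by (simp add: Z_node_def)

lemma Z_edge_ratio:
  assumes "(i, j) \<in> dir_edges R"
  shows "Z_edge R i j / (Z_node R i * Z_node R j) = 1 - r_prime R i j * r_prime R j i"
proof -
  have ij: "i < n" "j < n" using assms by (auto simp: dir_edges_def)
  define a b p where "a = 1 - alpha_excl R i j" and "b = 1 - alpha_excl R j i"
    and "p = 1 - r_prime R i j * r_prime R j i"
  have pos: "a > 0" "b > 0" "p > 0"
    using one_minus_alpha_excl_pos ij one_minus_r_prime_mult_pos[OF assms]
    by (auto simp: a_def b_def p_def)
  have "Z_edge R i j = inverse (a * b - R $$ (i, j) * R $$ (i, j))"
    unfolding Z_edge_def a_def b_def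
    by (subst det_carrier_mat_2) (simp_all add: mat_of_rows_list_def numeral_2_eq_2)
  also have "a * b - R $$ (i, j) * R $$ (i, j) = a * b * p"
    using pos sym[OF ij] by (simp add: p_def r_prime_def a_def[symmetric] b_def[symmetric] field_simps)
  finally have edge: "Z_edge R i j = inverse (a * b * p)" .
  have node_i: "Z_node R i = inverse (a * p)"
    unfolding Z_node_def one_minus_sum_alpha_eq[OF assms] a_def p_def ..
  have node_j: "Z_node R j = inverse (b * p)"
    unfolding Z_node_def one_minus_sum_alpha_eq[OF dir_edges_swap[OF assms]] b_def p_def
    by (simp add: mult_ac)
  show ?thesis unfolding edge node_i node_j p_def[symmetric] using pos by (simp add: field_simps)
qed

abbreviation r' :: "nat \<times> nat \<Rightarrow> real" where
  "r' \<equiv> case_prod (r_prime R)"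

lemma undir_edges_subset: "undir_edges R \<subseteq> dir_edges R"
  by (auto simp: undir_edges_def dir_edges_def)

lemma finite_undir_edges: "finite (undir_edges R)"
  using undir_edges_subset finite_dir_edges by (rule finite_subset)

lemma dir_edges_eq: "dir_edges R = undir_edges R \<union> prod.swap ` undir_edges R"
proof (intro equalityI subsetI)
  fix e assume e: "e \<in> dir_edges R"
  obtain i j where ij: "e = (i, j)" by force
  have "i \<noteq> j" using e zero_diag by (auto simp: ij dir_edges_def)
  then have "(i, j) \<in> undir_edges R \<or> (j, i) \<in> undir_edges R"
    using e dir_edges_swap[of i j] by (auto simp: ij undir_edges_def dir_edges_def)
  then show "e \<in> undir_edges R \<union> prod.swap ` undir_edges R"
    unfolding ij by (auto intro: rev_image_eqI)
qed (use undir_edges_subset dir_edges_swap in fastforce)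

lemma Z_bp_eq: "Z_bp R = (\<Prod>i<n. Z_node R i) * (\<Prod>e\<in>undir_edges R. 1 - r' e * r' (prod.swap e))"
  unfolding Z_bp_def dim_R
  using Z_edge_ratio undir_edges_subset
  by (intro arg_cong[of _ _ "\<lambda>t. _ * t"] prod.cong refl) (auto simp: case_prod_unfold)

lemma Z_bp_pos: "Z_bp R > 0"
  unfolding Z_bp_eq
  using Z_node_pos one_minus_r_prime_mult_pos undir_edges_subset
  by (intro mult_pos_pos prod_pos) (auto simp: case_prod_unfold)

lemma resummed_weight_r_prime:
  assumes "(i, j) \<in> dir_edges R"
  shows "resummed_weight r' (i, j) = R $$ (i, j) * Z_node R i"
  unfolding Z_node_def one_minus_sum_alpha_eq[OF assms]
  by (simp add: resummed_weight_def r_prime_def divide_inverse)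

lemma bass_entry_r_prime:
  assumes i: "i < n" and j: "j < n"
  shows "bass_entry (dir_edges R) r' i j = Z_node R i * ((if i = j then 1 else 0) - R $$ (i, j))"
proof -
  have "{e \<in> dir_edges R. fst e = i} = Pair i ` nbrs R i"
    using i by (auto simp: dir_edges_def nbrs_eq)
  then have "(\<Sum>e | e \<in> dir_edges R \<and> fst e = i. resummed_weight r' e * r' (prod.swap e))
      = (\<Sum>k\<in>nbrs R i. resummed_weight r' (i, k) * r_prime R k i)"
    by (simp add: sum.reindex inj_on_def)
  also have "\<dots> = (\<Sum>k\<in>nbrs R i. Z_node R i * alpha R k i)"
  proof (rule sum.cong)
    fix k assume "k \<in> nbrs R i"
    then have "k < n" "(i, k) \<in> dir_edges R" using i by (auto simp: nbrs_eq dir_edges_def)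
    then show "resummed_weight r' (i, k) * r_prime R k i = Z_node R i * alpha R k i"
      using sym[OF i] by (simp add: resummed_weight_r_prime alpha_eq i)
  qed simp
  also have "\<dots> = Z_node R i - Z_node R i * (1 - (\<Sum>k\<in>nbrs R i. alpha R k i))"
    by (simp add: sum_distrib_left[symmetric] right_diff_distrib)
  also have "\<dots> = Z_node R i - 1" using one_minus_sum_alpha_pos[OF i] by (simp add: Z_node_def)
  finally have "1 + (\<Sum>e | e \<in> dir_edges R \<and> fst e = i. resummed_weight r' e * r' (prod.swap e))
      = Z_node R i" by simp
  moreover have "(if (i, j) \<in> dir_edges R then resummed_weight r' (i, j) else 0)
      = Z_node R i * R $$ (i, j)"
    using resummed_weight_r_prime[of i j] i j by (auto simp: dir_edges_def)
  ultimately show ?thesis by (cases "i = j") (auto simp: bass_entry_def right_diff_distrib)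
qed

lemma det_nonbacktracking_eq_Z_bp:
  obtains es where "distinct es" "set es = dir_edges R"
    and "det (1\<^sub>m (length es) - indexed_mat es es (nonbacktracking_weight r'))
      = Z_bp R * det (1\<^sub>m n - R)"
proof -
  obtain us where us: "distinct us" "set us = undir_edges R"
    using finite_distinct_list[OF finite_undir_edges] by blast
  interpret arc_list us "[0..<n]" r'
  proof
    have "undir_edges R \<inter> prod.swap ` undir_edges R = {}" by (auto simp: undir_edges_def)
    then show "distinct (us @ map prod.swap us)" using us by (simp add: distinct_map)
    show "fst ` set us \<union> snd ` set us \<subseteq> set [0..<n]" by (auto simp: us(2) undir_edges_def)
    show "r' e * r' (prod.swap e) \<noteq> 1" if "e \<in> set us" for e
      using one_minus_r_prime_mult_pos[of "fst e" "snd e"] that undir_edges_subset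
      by (auto simp: us(2) case_prod_unfold)
  qed simp
  have set_arcs: "set arcs = dir_edges R" by (simp add: us(2) dir_edges_eq)
  have "indexed_mat [0..<n] [0..<n] (bass_entry (set arcs) r')
      = indexed_mat [0..<n] [0..<n] (\<lambda>i j. Z_node R i * ((if i = j then 1 else 0) - R $$ (i, j)))"
    unfolding set_arcs by (rule indexed_mat_cong) (auto simp: bass_entry_r_prime)
  moreover have "indexed_mat [0..<n] [0..<n] (\<lambda>i j. (if i = j then 1 else 0) - R $$ (i, j))
      = 1\<^sub>m n - R"
    by (rule eq_matI) auto
  ultimately have "det (indexed_mat [0..<n] [0..<n] (bass_entry (set arcs) r'))
      = (\<Prod>i<n. Z_node R i) * det (1\<^sub>m n - R)"
    by (simp only: det_scale_rows_indexed_mat[OF distinct_upt]) (simp add: lessThan_atLeast0)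
  then have "det (1\<^sub>m (length arcs) - indexed_mat arcs arcs (nonbacktracking_weight r'))
      = Z_bp R * det (1\<^sub>m n - R)"
    unfolding det_one_minus_nonbacktracking us(2) Z_bp_eq by (simp only: mult_ac)
  with distinct_arcs set_arcs show ?thesis by (rule that)
qed

section \<open>The orbit product\<close>

text \<open>
  On a tree with \<open>R \<ge> 0\<close> and \<open>(I - R) x = 1\<close>, the factor \<open>x\<^sub>i - r'\<^sub>i\<^sub>j x\<^sub>j\<close> is the solution at \<open>i\<close> of the
  system from which the neighbour \<open>j\<close> has been deleted.
\<close>

definition edge_potential :: "nat \<times> nat \<Rightarrow> real" where
  "edge_potential = (\<lambda>(i, j). \<bar>R $$ (i, j)\<bar> * (x i - \<bar>r_prime R i j\<bar> * x j))"

lemma edge_potential_pos: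
  assumes "e \<in> dir_edges R"
  shows "edge_potential e > 0"
proof -
  obtain i j where e: "e = (i, j)" by force
  have ij: "i < n" "j < n" "R $$ (i, j) \<noteq> 0" using assms e by (auto simp: dir_edges_def)
  then have "\<bar>r_prime R i j\<bar> * x j < x i"
    using one_minus_alpha_excl_gt[OF ij(1,2)] one_minus_alpha_excl_pos[OF ij(1,2)]
    by (simp add: r_prime_def abs_divide field_simps)
  then show ?thesis using ij by (simp add: edge_potential_def e)
qed

lemma edge_potential_eq:
  assumes "k < n" "i < n"
  shows "edge_potential (k, i) = \<bar>R $$ (i, k)\<bar> * x k - x i * alpha R k i"
proof -
  have "alpha R k i = \<bar>R $$ (k, i)\<bar> * \<bar>r_prime R k i\<bar>"
    using alpha_eq[OF assms] alpha_bounds(1)[OF assms] by (metis abs_mult abs_of_nonneg)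
  then show ?thesis using sym[OF assms] by (simp add: edge_potential_def algebra_simps)
qed

lemma sum_edge_potential_less:
  assumes "f \<in> dir_edges R"
  shows "(\<Sum>e\<in>dir_edges R. edge_potential e * \<bar>nonbacktracking_weight r' e f\<bar>) < edge_potential f"
proof -
  obtain i j where f: "f = (i, j)" by force
  have ij: "i < n" "j < n" "R $$ (i, j) \<noteq> 0" using assms f by (auto simp: dir_edges_def)
  let ?u = "\<bar>r_prime R i j\<bar>" and ?r = "\<bar>R $$ (i, j)\<bar>" and ?d = "1 - alpha_excl R i j"
  have u: "?u > 0" "?u * ?d = ?r"
    using one_minus_alpha_excl_pos[OF ij(1,2)] ij(3) by (simp_all add: r_prime_def abs_divide)
  have into: "{e \<in> dir_edges R. nonbacktracking e f} = (\<lambda>k. (k, i)) ` (nbrs R i - {j})"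
    using ij(1) sym by (auto simp: f nonbacktracking_def dir_edges_def nbrs_eq image_iff)
  have "(\<Sum>e\<in>dir_edges R. edge_potential e * \<bar>nonbacktracking_weight r' e f\<bar>)
      = (\<Sum>e\<in>dir_edges R. if nonbacktracking e f then edge_potential e * ?u else 0)"
    by (rule sum.cong) (auto simp: nonbacktracking_weight_def f)
  also have "\<dots> = (\<Sum>e\<in>{e \<in> dir_edges R. nonbacktracking e f}. edge_potential e * ?u)"
    by (rule sum.inter_filter[OF finite_dir_edges, symmetric])
  also have "\<dots> = (\<Sum>k\<in>nbrs R i - {j}. edge_potential (k, i)) * ?u"
    unfolding into by (simp add: sum.reindex inj_on_def sum_distrib_right)
  also have "(\<Sum>k\<in>nbrs R i - {j}. edge_potential (k, i))
      = (\<Sum>k\<in>nbrs R i - {j}. \<bar>R $$ (i, k)\<bar> * x k - x i * alpha R k i)"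
    using ij(1) by (intro sum.cong edge_potential_eq) (auto simp: nbrs_eq)
  also have "\<dots> = (\<Sum>k\<in>nbrs R i - {j}. \<bar>R $$ (i, k)\<bar> * x k) - x i * alpha_excl R i j"
    by (simp add: sum_subtractf sum_distrib_left alpha_excl_def)
  also have "\<dots> * ?u < (x i - ?r * x j - x i * alpha_excl R i j) * ?u"
    using neighbour_sum_less[OF ij(1,2)] u(1) by (intro mult_strict_right_mono) auto
  also have "\<dots> = (?u * ?d) * x i - ?u * ?r * x j" by (simp add: algebra_simps)
  also have "\<dots> = edge_potential f" unfolding u(2) by (simp add: edge_potential_def f algebra_simps)
  finally show ?thesis .
qed

abbreviation complex_r' :: "nat \<times> nat \<Rightarrow> complex" where
  "complex_r' \<equiv> \<lambda>e. complex_of_real (r' e)"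

lemma nonbacktracking_cyclic_log_sum:
  obtains L where "cyclic_log_sum (nonbacktracking_weight complex_r') (dir_edges R) L"
    and "exp L = complex_of_real (inverse (Z_bp R * det (1\<^sub>m n - R)))"
proof -
  have weight: "nonbacktracking_weight complex_r' e f
      = complex_of_real (nonbacktracking_weight r' e f)" for e f
    by (simp add: nonbacktracking_weight_def)
  obtain es where es: "distinct es" "set es = dir_edges R"
    and det: "det (1\<^sub>m (length es) - indexed_mat es es (nonbacktracking_weight r'))
      = Z_bp R * det (1\<^sub>m n - R)"
    by (rule det_nonbacktracking_eq_Z_bp)
  have "strictly_subinvariant (set es) edge_potential (nonbacktracking_weight complex_r')"
    by (simp add: strictly_subinvariant_def es(2) weight edge_potential_pos sum_edge_potential_less)
  then obtain L where sum: "cyclic_log_sum (nonbacktracking_weight complex_r') (set es) L"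
    and exp_L: "exp L
      = inverse (det (1\<^sub>m (length es) - indexed_mat es es (nonbacktracking_weight complex_r')))"
    using cyclic_log_sum_eq_log_det[OF es(1)] by blast
  have "1\<^sub>m (length es) - indexed_mat es es (nonbacktracking_weight complex_r')
      = map_mat complex_of_real (1\<^sub>m (length es) - indexed_mat es es (nonbacktracking_weight r'))"
    by (rule eq_matI) (auto simp: weight)
  then have "det (1\<^sub>m (length es) - indexed_mat es es (nonbacktracking_weight complex_r'))
      = complex_of_real (Z_bp R * det (1\<^sub>m n - R))"
    by (simp only: of_real_hom.hom_det det)
  then have "exp L = complex_of_real (inverse (Z_bp R * det (1\<^sub>m n - R)))"
    by (simp only: exp_L of_real_inverse)
  with sum show ?thesis unfolding es(2) by (rule that)
qed

lemma prod_list_orbit_steps: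
  assumes "\<gamma> \<in> backtrackless_orbits R"
  shows "prod_list (map complex_r' (orbit_steps \<gamma>)) = complex_of_real (orbit_weight R \<gamma>)"
proof -
  have "\<gamma> \<in> orbits R" using assms by (simp add: backtrackless_orbits_def)
  moreover have "prod_list (map complex_r' es) = complex_of_real (prod_list (map r' es))" for es
    by (induction es) auto
  ultimately show ?thesis by (simp add: orbit_weight_eq)
qed

lemma orbit_product_tendsto:
  "((\<lambda>F. \<Prod>\<gamma>\<in>F. inverse (1 - orbit_weight R \<gamma>)) \<longlongrightarrow> inverse (Z_bp R * det (1\<^sub>m n - R)))
     (finite_subsets_at_top (backtrackless_orbits R))"
proof -
  obtain L where sum: "cyclic_log_sum (nonbacktracking_weight complex_r') (dir_edges R) L"
    and exp_L: "exp L = complex_of_real (inverse (Z_bp R * det (1\<^sub>m n - R)))"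
    by (rule nonbacktracking_cyclic_log_sum)
  have "((\<lambda>F. \<Prod>\<gamma>\<in>F. inverse (1 - complex_of_real (orbit_weight R \<gamma>))) \<longlongrightarrow> exp L)
      (finite_subsets_at_top (backtrackless_orbits R))"
  proof (rule prod_inverse_one_minus_tendsto)
    show "((\<lambda>\<gamma>. - Ln (1 - complex_of_real (orbit_weight R \<gamma>))) has_sum L) (backtrackless_orbits R)"
      using backtrackless_orbits_has_sum[OF sum]
      by (simp add: prod_list_orbit_steps cong: has_sum_cong)
    show "cmod (complex_of_real (orbit_weight R \<gamma>)) < 1" if "\<gamma> \<in> backtrackless_orbits R" for \<gamma>
      using norm_prod_list_orbit_steps_less_one[OF sum that] by (simp only: prod_list_orbit_steps[OF that])
  qed
  then have "((\<lambda>F. complex_of_real (\<Prod>\<gamma>\<in>F. inverse (1 - orbit_weight R \<gamma>)))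
      \<longlongrightarrow> complex_of_real (inverse (Z_bp R * det (1\<^sub>m n - R))))
      (finite_subsets_at_top (backtrackless_orbits R))"
    by (simp add: exp_L)
  then show ?thesis by (simp only: tendsto_of_real_iff)
qed

end

theorem theorem4:
  fixes R :: "real mat" and n :: nat
  assumes "R \<in> carrier_mat n n"
    and "transpose_mat R = R"
    and "\<forall>i<n. R $$ (i, i) = 0"
    and "spectral_radius (map_mat (\<lambda>x. complex_of_real \<bar>x\<bar>) R) < 1"
  shows "\<exists>P. ((\<lambda>F. \<Prod>\<gamma>\<in>F. inverse (1 - orbit_weight R \<gamma>)) \<longlongrightarrow> P)
              (finite_subsets_at_top (backtrackless_orbits R))
           \<and> inverse (det (1\<^sub>m n - R)) = Z_bp R * P"
proof -
  let ?B = "map_mat abs R"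
  have B: "?B \<in> carrier_mat n n" using assms(1) by simp
  have "map_mat (\<lambda>x. complex_of_real \<bar>x\<bar>) R = map_mat complex_of_real ?B"
    by (rule eq_matI) auto
  then have "spectrum (map_mat complex_of_real ?B) \<subseteq> ball 0 1"
    using B assms(4) by (intro spectrum_subset_ball_if_spectral_radius_less[of _ n]) simp_all
  then obtain x where "\<And>i. i < n \<Longrightarrow> x i > 0" "\<And>i. i < n \<Longrightarrow> (\<Sum>k<n. ?B $$ (i, k) * x k) < x i"
    using positive_superharmonic_vector_exists[OF B] assms(1) by auto
  moreover have "R $$ (i, j) = R $$ (j, i)" if "i < n" "j < n" for i j
    using assms(1) that arg_cong[OF assms(2), of "\<lambda>A. A $$ (i, j)"] by simp
  ultimately interpret scaled_diagonally_dominant R n x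
    using assms(1,3) by unfold_locales auto
  show ?thesis
    using orbit_product_tendsto Z_bp_pos by (intro exI[of _ "inverse (Z_bp R * det (1\<^sub>m n - R))"]) simp
qed

end
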